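(* Let $N\ge2$ and let $(S_i)_{i\in\mathbb{Z}_N}$ be the wavelet representation of $\mathcal{O}_N$ on $L^2(\mathbb{T})$ associated to a QMF system $(m_i)_{i\in\mathbb{Z}_N}$, where all the functions $m_i$ are trigonometric polynomials. Then the following statements are equivalent: (i) The representation has an atom. (ii) There exist $p\ge1$ and $i_0,\dots,i_{p-1}$ in $\mathbb{Z}_N$ such that for all $j=0,\dots,p-1$ we have $m_{i_j}(z)=a_jz^{k_j}$ for some $a_j\in\mathbb{T}$, $k_j\in\mathbb{Z}$, and $k_0+Nk_1+\dots+N^{p-1}k_{p-1}$ is a multiple of $N^p-1$.
   Context: $\mathbb{Z}_N=\{0,1,\dots,N-1\}$ and $\mathbb{T}=\{z\in\mathbb{C}:|z|=1\}$ with (normalized) Haar measure. A family of $N$ functions $m_i\in L^2(\mathbb{T})$, $i\in\mathbb{Z}_N$, is a QMF system if $$\frac1N\sum_{w^N=z}m_i(w)\overline{m_j(w)}=\delta_{ij},\qquad(i,j\in\mathbb{Z}_N,\ z\in\mathbb{T}).$$ The associated wavelet representation is given by the operators on $L^2(\mathbb{T})$ $$S_if(z)=m_i(z)f(z^N),\qquad(f\in L^2(\mathbb{T}),z\in\mathbb{T}),$$ which satisfy the Cuntz relations $S_i^*S_j=\delta_{ij}I$, $\sum_{i\in\mathbb{Z}_N}S_iS_i^*=I$, i.e., form a representation of the Cuntz algebra $\mathcal{O}_N$. A trigonometric polynomial is a finite linear combination of the functions $z^k$, $k\in\mathbb{Z}$. For a finite word $I=i_1\dots i_n$ over $\mathbb{Z}_N$,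 $S_I:=S_{i_1}\cdots S_{i_n}$. $\mathcal{K}_N=\mathbb{Z}_N^{\mathbb{N}}$ is the space of infinite words with the product topology. The projection valued measure $P$ associated to the representation is the unique projection valued measure on the Borel sets of $\mathcal{K}_N$ with $P(\{\omega:\omega_1=i_1,\dots,\omega_k=i_k\})=S_IS_I^*$ for every finite word $I=i_1\dots i_k$. The representation has an atom if there is $\omega\in\mathcal{K}_N$ with $P(\{\omega\})\ne0$. *)

theory Defs
  imports "HOL-Analysis.Analysis"
begin

section \<open>The Hilbert space of square-integrable functions on the circle\<close>

abbreviation circle :: "complex set" where
  "circle \<equiv> sphere 0 1"

text \<open>Normalized Haar measure, as the image of Lebesgue measure on \<open>[0,1)\<close>.  Its space is the
  circle, so values of functions off the circle are irrelevant.\<close>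

definition haar :: "complex measure" where
  "haar = distr (restrict_space lborel {0..<1::real}) (restrict_space borel circle)
            (\<lambda>t. cis (2 * pi * t))"

definition square_integrable :: "'a measure \<Rightarrow> ('a \<Rightarrow> complex) \<Rightarrow> bool" where
  "square_integrable M f \<longleftrightarrow> f \<in> borel_measurable M \<and> integrable M (\<lambda>x. (cmod (f x))\<^sup>2)"

lemma square_integrable_zero: "square_integrable M (\<lambda>x. 0)"
  by (simp add: square_integrable_def)

lemma square_integrable_cmult:
  assumes "square_integrable M f"
  shows "square_integrable M (\<lambda>x. c * f x)"
  using assms by (auto simp: square_integrable_def norm_mult power_mult_distrib)

lemma square_integrable_add:
  assumes f: "square_integrable M f" and g: "square_integrable M g"
  shows "square_integrable M (\<lambda>x. f x + g x)"
proof -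
  have "integrable M (\<lambda>x. 2 * (cmod (f x))\<^sup>2 + 2 * (cmod (g x))\<^sup>2)"
    using f g by (auto simp: square_integrable_def)
  moreover have "(\<lambda>x. (cmod (f x + g x))\<^sup>2) \<in> borel_measurable M"
    using f g by (auto simp: square_integrable_def)
  moreover
  have "(cmod (a + b))\<^sup>2 \<le> 2 * (cmod a)\<^sup>2 + 2 * (cmod b)\<^sup>2" for a b
  proof -
    have "(cmod (a + b))\<^sup>2 \<le> (cmod a + cmod b)\<^sup>2"
      by (intro power_mono norm_triangle_ineq) auto
    also have "\<dots> \<le> 2 * (cmod a)\<^sup>2 + 2 * (cmod b)\<^sup>2"
      using sum_squares_ge_zero[of "cmod a - cmod b" 0] by (simp add: power2_eq_square algebra_simps)
    finally show ?thesis .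
  qed
  then have "AE x in M. norm ((cmod (f x + g x))\<^sup>2) \<le> norm (2 * (cmod (f x))\<^sup>2 + 2 * (cmod (g x))\<^sup>2)"
    by simp
  ultimately have "integrable M (\<lambda>x. (cmod (f x + g x))\<^sup>2)"
    by (rule Bochner_Integration.integrable_bound)
  then show ?thesis
    using f g by (auto simp: square_integrable_def)
qed

lemma square_integrable_mult_cnj:
  assumes f: "square_integrable M f" and g: "square_integrable M g"
  shows "integrable M (\<lambda>x. f x * cnj (g x))"
proof -
  have "integrable M (\<lambda>x. (cmod (f x))\<^sup>2 + (cmod (g x))\<^sup>2)"
    using f g by (auto simp: square_integrable_def)
  moreover have "(\<lambda>x. f x * cnj (g x)) \<in> borel_measurable M"
    using f g by (auto simp: square_integrable_def intro!: borel_measurable_times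
        borel_measurable_continuous_on[where f=cnj] continuous_intros)
  moreover
  have "cmod (a * cnj b) \<le> (cmod a)\<^sup>2 + (cmod b)\<^sup>2" for a b
  proof -
    have "2 * (cmod a * cmod b) \<le> (cmod a)\<^sup>2 + (cmod b)\<^sup>2"
      using sum_squares_ge_zero[of "cmod a - cmod b" 0] by (simp add: power2_eq_square algebra_simps)
    moreover have "0 \<le> cmod a * cmod b" by simp
    ultimately show ?thesis unfolding norm_mult complex_mod_cnj by linarith
  qed
  then have "AE x in M. norm (f x * cnj (g x)) \<le> norm ((cmod (f x))\<^sup>2 + (cmod (g x))\<^sup>2)"
    by simp
  ultimately show ?thesis
    by (rule Bochner_Integration.integrable_bound)
qed

definition l2_rel :: "(complex \<Rightarrow> complex) \<Rightarrow> (complex \<Rightarrow> complex) \<Rightarrow> bool" where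
  "l2_rel f g \<longleftrightarrow> square_integrable haar f \<and> square_integrable haar g \<and> (AE z in haar. f z = g z)"

quotient_type l2_circle = "complex \<Rightarrow> complex" / partial: l2_rel
proof (rule part_equivpI)
  show "\<exists>f. l2_rel f f"
    using square_integrable_zero by (auto simp: l2_rel_def)
  show "symp l2_rel"
    by (auto simp: symp_def l2_rel_def)
  show "transp l2_rel"
    by (auto simp: transp_def l2_rel_def)
qed

lift_definition scaleC :: "complex \<Rightarrow> l2_circle \<Rightarrow> l2_circle" (infixr "*\<^sub>C" 75)
  is "\<lambda>c f z. c * f z"
  by (auto simp: l2_rel_def square_integrable_cmult)

lift_definition cinner :: "l2_circle \<Rightarrow> l2_circle \<Rightarrow> complex"
  is "\<lambda>f g. \<integral>z. f z * cnj (g z) \<partial>haar"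
proof -
  fix f f' g g'
  assume "l2_rel f f'" "l2_rel g g'"
  then have "square_integrable haar f" "square_integrable haar f'"
    "square_integrable haar g" "square_integrable haar g'"
    and ae: "AE z in haar. f z = f' z" "AE z in haar. g z = g' z"
    by (auto simp: l2_rel_def)
  then have i: "integrable haar (\<lambda>z. f z * cnj (g z))" "integrable haar (\<lambda>z. f' z * cnj (g' z))"
    by (auto intro: square_integrable_mult_cnj)
  show "(\<integral>z. f z * cnj (g z) \<partial>haar) = (\<integral>z. f' z * cnj (g' z) \<partial>haar)"
    using ae by (intro integral_cong_AE borel_measurable_integrable i) auto
qed

text \<open>The real Hilbert space structure underlying the complex one; its norm is the
  \<open>L\<^sup>2\<close> norm.\<close>

instantiation l2_circle :: real_inner
begin

lift_definition zero_l2_circle :: l2_circle is "\<lambda>z. 0"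
  by (simp add: l2_rel_def square_integrable_zero)

lift_definition plus_l2_circle :: "l2_circle \<Rightarrow> l2_circle \<Rightarrow> l2_circle"
  is "\<lambda>f g z. f z + g z"
  by (auto simp: l2_rel_def square_integrable_add)

definition uminus_l2_circle :: "l2_circle \<Rightarrow> l2_circle" where
  "uminus_l2_circle f = (- 1) *\<^sub>C f"

definition minus_l2_circle :: "l2_circle \<Rightarrow> l2_circle \<Rightarrow> l2_circle" where
  "minus_l2_circle f g = f + (- g)"

definition scaleR_l2_circle :: "real \<Rightarrow> l2_circle \<Rightarrow> l2_circle" where
  "scaleR_l2_circle r f = complex_of_real r *\<^sub>C f"

definition inner_l2_circle :: "l2_circle \<Rightarrow> l2_circle \<Rightarrow> real" where
  "inner_l2_circle f g = Re (cinner f g)"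

definition norm_l2_circle :: "l2_circle \<Rightarrow> real" where
  "norm_l2_circle f = sqrt (inner f f)"

definition sgn_l2_circle :: "l2_circle \<Rightarrow> l2_circle" where
  "sgn_l2_circle f = scaleR (inverse (norm f)) f"

definition dist_l2_circle :: "l2_circle \<Rightarrow> l2_circle \<Rightarrow> real" where
  "dist_l2_circle f g = norm (f - g)"

definition uniformity_l2_circle :: "(l2_circle \<times> l2_circle) filter" where
  "uniformity_l2_circle = (INF e\<in>{0<..}. principal {(x, y). dist x y < e})"

definition open_l2_circle :: "l2_circle set \<Rightarrow> bool" where
  "open_l2_circle U = (\<forall>x\<in>U. eventually (\<lambda>(x', y). x' = x \<longrightarrow> y \<in> U) uniformity)"

instance
proof
  fix f g h :: l2_circle and r s :: real
  show "f + g + h = f + (g + h)"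
    by transfer (auto simp: l2_rel_def algebra_simps square_integrable_add)
  show "f + g = g + f"
    by transfer (auto simp: l2_rel_def algebra_simps square_integrable_add)
  show "0 + f = f"
    by transfer (auto simp: l2_rel_def)
  show "- f + f = 0"
    unfolding uminus_l2_circle_def
    by transfer (auto simp: l2_rel_def square_integrable_zero)
  show "f - g = f + - g"
    by (rule minus_l2_circle_def)
  show "r *\<^sub>R (f + g) = r *\<^sub>R f + r *\<^sub>R g"
    unfolding scaleR_l2_circle_def
    by transfer (auto simp: l2_rel_def distrib_left distrib_right square_integrable_add square_integrable_cmult)
  show "(r + s) *\<^sub>R f = r *\<^sub>R f + s *\<^sub>R f"
    unfolding scaleR_l2_circle_def
    by transfer (auto simp: l2_rel_def distrib_left distrib_right square_integrable_add square_integrable_cmult)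
  show "r *\<^sub>R s *\<^sub>R f = (r * s) *\<^sub>R f"
    unfolding scaleR_l2_circle_def
  proof transfer
    fix r s f
    assume "l2_rel f f"
    then have "square_integrable haar (\<lambda>z. complex_of_real (r * s) * f z)"
      by (auto simp: l2_rel_def intro: square_integrable_cmult)
    then show "l2_rel (\<lambda>z. complex_of_real r * (complex_of_real s * f z))
      (\<lambda>z. complex_of_real (r * s) * f z)"
      by (simp add: l2_rel_def mult.assoc)
  qed
  show "1 *\<^sub>R f = f"
    unfolding scaleR_l2_circle_def by transfer (auto simp: l2_rel_def)
  show "sgn f = scaleR (inverse (norm f)) f"
    by (rule sgn_l2_circle_def)
  show "dist f g = norm (f - g)"
    by (rule dist_l2_circle_def)
  show "(uniformity :: (l2_circle \<times> l2_circle) filter) = (INF e\<in>{0<..}. principal {(x, y). dist x y < e})"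
    by (rule uniformity_l2_circle_def)
  show "open U = (\<forall>x\<in>U. eventually (\<lambda>(x', y). x' = x \<longrightarrow> y \<in> U) uniformity)"
    for U :: "l2_circle set"
    by (rule open_l2_circle_def)
  show "inner f g = inner g f"
    unfolding inner_l2_circle_def
  proof transfer
    fix f g :: "complex \<Rightarrow> complex"
    have "(\<integral>z. g z * cnj (f z) \<partial>haar) = (\<integral>z. cnj (f z * cnj (g z)) \<partial>haar)"
      by (simp add: mult.commute)
    also have "\<dots> = cnj (\<integral>z. f z * cnj (g z) \<partial>haar)"
      by (rule Bochner_Integration.integral_cnj)
    finally show "Re (\<integral>z. f z * cnj (g z) \<partial>haar) = Re (\<integral>z. g z * cnj (f z) \<partial>haar)"
      by simp
  qed
  show "inner (f + g) h = inner f h + inner g h"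
    unfolding inner_l2_circle_def
    by transfer (simp add: l2_rel_def distrib_right square_integrable_mult_cnj)
  show "inner (r *\<^sub>R f) g = r * inner f g"
    unfolding inner_l2_circle_def scaleR_l2_circle_def
    by transfer (simp add: l2_rel_def mult.assoc)
  have sq: "Re (\<integral>z. u z * cnj (u z) \<partial>haar) = (\<integral>z. (cmod (u z))\<^sup>2 \<partial>haar)" for u
    by (simp add: complex_norm_square[symmetric] del: of_real_power)
  show "0 \<le> inner f f"
    unfolding inner_l2_circle_def by transfer (simp add: sq)
  show "inner f f = 0 \<longleftrightarrow> f = 0"
    unfolding inner_l2_circle_def
  proof transfer
    fix f
    assume "l2_rel f f"
    then have "integrable haar (\<lambda>z. (cmod (f z))\<^sup>2)" and f: "square_integrable haar f"
      by (auto simp: l2_rel_def square_integrable_def)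
    then have "(\<integral>z. (cmod (f z))\<^sup>2 \<partial>haar) = 0 \<longleftrightarrow> (AE z in haar. (cmod (f z))\<^sup>2 = 0)"
      by (intro integral_nonneg_eq_0_iff_AE) auto
    then show "Re (\<integral>z. f z * cnj (f z) \<partial>haar) = 0 \<longleftrightarrow> l2_rel f (\<lambda>z. 0)"
      by (simp add: sq l2_rel_def f square_integrable_zero)
  qed
  show "norm f = sqrt (inner f f)"
    by (rule norm_l2_circle_def)
qed

end

definition clinear :: "(l2_circle \<Rightarrow> l2_circle) \<Rightarrow> bool" where
  "clinear T \<longleftrightarrow> (\<forall>f g. T (f + g) = T f + T g) \<and> (\<forall>c f. T (c *\<^sub>C f) = c *\<^sub>C T f)"

text \<open>The Hilbert space adjoint; it exists and is unique for bounded complex-linear operators.\<close>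

definition cadjoint :: "(l2_circle \<Rightarrow> l2_circle) \<Rightarrow> l2_circle \<Rightarrow> l2_circle" where
  "cadjoint T = (THE A. \<forall>f g. cinner (T f) g = cinner f (A g))"

definition orthogonal_projection :: "(l2_circle \<Rightarrow> l2_circle) \<Rightarrow> bool" where
  "orthogonal_projection T \<longleftrightarrow>
     clinear T \<and> T \<circ> T = T \<and> (\<forall>f g. cinner (T f) g = cinner f (T g))"

text \<open>Countable additivity is with respect to the strong operator topology.\<close>

definition projection_valued_measure ::
    "'a measure \<Rightarrow> ('a set \<Rightarrow> l2_circle \<Rightarrow> l2_circle) \<Rightarrow> bool" where
  "projection_valued_measure M P \<longleftrightarrow>
     (\<forall>E\<in>sets M. orthogonal_projection (P E)) \<and>
     P (space M) = id \<and>
     (\<forall>E\<in>sets M. \<forall>F\<in>sets M. P (E \<inter> F) = P E \<circ> P F) \<and>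
     (\<forall>A::nat \<Rightarrow> 'a set. range A \<subseteq> sets M \<longrightarrow> disjoint_family A \<longrightarrow>
        (\<forall>f. (\<lambda>n. P (A n) f) sums P (\<Union>n. A n) f))"

section \<open>Wavelet representations\<close>

definition trigonometric_polynomial :: "(complex \<Rightarrow> complex) \<Rightarrow> bool" where
  "trigonometric_polynomial f \<longleftrightarrow>
     (\<exists>K c. finite (K :: int set) \<and> (\<forall>z\<in>circle. f z = (\<Sum>k\<in>K. c k * z powi k)))"

text \<open>The \<open>m i\<close> stand for elements of \<open>L\<^sup>2\<close>, so the identity is required for almost every
  \<open>z\<close> only.\<close>

definition qmf_system :: "nat \<Rightarrow> (nat \<Rightarrow> complex \<Rightarrow> complex) \<Rightarrow> bool" where
  "qmf_system N m \<longleftrightarrow>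
     (\<forall>i<N. square_integrable haar (m i)) \<and>
     (\<forall>i<N. \<forall>j<N. AE z in haar.
        1 / of_nat N * (\<Sum>w | w ^ N = z. m i w * cnj (m j w)) = (if i = j then 1 else 0))"

text \<open>\<open>rep_l2_circle f\<close> is some function in the class \<open>f\<close>; for a QMF system the product below is
  square-integrable and its class does not depend on that choice.\<close>

definition wavelet_op ::
    "nat \<Rightarrow> (nat \<Rightarrow> complex \<Rightarrow> complex) \<Rightarrow> nat \<Rightarrow> l2_circle \<Rightarrow> l2_circle" where
  "wavelet_op N m i f = abs_l2_circle (\<lambda>z. m i z * rep_l2_circle f (z ^ N))"

definition word_op :: "(nat \<Rightarrow> l2_circle \<Rightarrow> l2_circle) \<Rightarrow> nat list \<Rightarrow> l2_circle \<Rightarrow> l2_circle" where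
  "word_op S I = foldr (\<lambda>i T. S i \<circ> T) I id"

definition word_space :: "nat \<Rightarrow> (nat \<Rightarrow> nat) topology" where
  "word_space N = product_topology (\<lambda>_. discrete_topology {..<N}) UNIV"

definition word_borel :: "nat \<Rightarrow> (nat \<Rightarrow> nat) measure" where
  "word_borel N = sigma (topspace (word_space N)) {U. openin (word_space N) U}"

text \<open>Letters are indexed from 0.\<close>

definition cylinder :: "nat \<Rightarrow> nat list \<Rightarrow> (nat \<Rightarrow> nat) set" where
  "cylinder N I = {\<omega> \<in> topspace (word_space N). \<forall>j<length I. \<omega> j = I ! j}"

text \<open>These conditions determine \<open>P\<close> on the Borel sets; its values elsewhere are irrelevant.\<close>

definition associated_pvm :: "nat \<Rightarrow> (nat \<Rightarrow> l2_circle \<Rightarrow> l2_circle) \<Rightarrow>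
    ((nat \<Rightarrow> nat) set \<Rightarrow> l2_circle \<Rightarrow> l2_circle) \<Rightarrow> bool" where
  "associated_pvm N S P \<longleftrightarrow>
     projection_valued_measure (word_borel N) P \<and>
     (\<forall>I. set I \<subseteq> {..<N} \<longrightarrow> P (cylinder N I) = word_op S I \<circ> cadjoint (word_op S I))"

definition has_atom :: "nat \<Rightarrow> ((nat \<Rightarrow> nat) set \<Rightarrow> l2_circle \<Rightarrow> l2_circle) \<Rightarrow> bool" where
  "has_atom N P \<longleftrightarrow> (\<exists>\<omega>\<in>topspace (word_space N). P {\<omega>} \<noteq> (\<lambda>f. 0))"

end

theory Submission
  imports Defs
begin

text \<open>
  Write \<open>e k\<close> for the monomial \<open>z powi k\<close>, and \<open>S I\<close> for the operator of a word \<open>I\<close>. The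
  projection of the cylinder of \<open>I\<close> is \<open>S I\<close> followed by its adjoint, and the projection of
  \<open>{\<omega>}\<close> is the strong limit of the projections of the cylinders of the prefixes of \<open>\<omega>\<close>.

  A monomial cycle gives an atom. If \<open>m i = a z powi k\<close> then \<open>S i\<close> sends \<open>e n\<close> to
  \<open>a e (k + N n)\<close>, so the word \<open>I\<close> of the cycle sends \<open>e n\<close> to a unimodular multiple of
  \<open>e (K + N ^ p n)\<close>, where \<open>K\<close> is the sum in the divisibility condition. That condition says
  that some integer \<open>n\<close> solves \<open>K + N ^ p n = n\<close>. Then \<open>e n\<close> is an eigenvector of \<open>S I\<close>, hence
  fixed by the projections of all cylinders around the periodic word, and by their limit
  (\<open>monomial_path_imp_fixed\<close>, \<open>monomial_cycle_imp_atom\<close>).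

  An atom gives a monomial cycle. The argument reduces to a comparison of degrees, in two moves.

  The first move replaces the atom vector by a trigonometric polynomial. By completeness of the
  monomials (\<open>fourier_complete\<close>) some \<open>e n\<close> is not annihilated by the projection of \<open>{\<omega>}\<close>.
  The adjoint of \<open>S i\<close> divides frequencies by \<open>N\<close>, up to a bounded error, so for large \<open>M\<close> the
  finite-dimensional space of trigonometric polynomials with frequencies in \<open>[-M, M]\<close> is
  invariant under all adjoints and contains \<open>e n\<close>. Applying to \<open>e n\<close> the adjoints of longer and
  longer prefixes of \<open>\<omega>\<close> keeps the norm away from \<open>0\<close>. If for some length \<open>L\<close> no word \<open>I\<close> of
  length \<open>L\<close> had a nonzero \<open>v\<close> in this space fixed by its cylinder projection, then by
  compactness of the unit sphere the adjoints of these finitely many words would be uniform strict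
  contractions on the space, and the norms would tend to \<open>0\<close>. So for every \<open>L\<close> there are such
  \<open>I\<close> and \<open>v\<close> (\<open>atom_imp_fixed_band_vector\<close>).

  The second move uses \<open>v = S I u\<close>, where both \<open>v\<close> and \<open>u\<close> are nonzero trigonometric polynomials.
  Write each trigonometric polynomial as a power of \<open>z\<close> times a polynomial with nonzero constant
  term. Each \<open>S i\<close> multiplies the exponent of this power and the degree of this polynomial by
  \<open>N\<close> and adds the corresponding numbers of \<open>m i\<close>. Along \<open>I\<close> the degrees therefore vanish from
  some position on, since \<open>v\<close> has degree at most \<open>2 M\<close>; there the letters are monomials. The
  exponents stay in \<open>[-M, M]\<close>, so two of them agree, and the recursion between the two is the
  divisibility condition (\<open>repeating_exponents\<close>). The moduli of the coefficients are \<open>1\<close> by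
  the QMF identity.
\<close>


section \<open>Geometry of the complex Hilbert space\<close>

lemma cinner_commute: "cinner g f = cnj (cinner f g)"
proof transfer
  fix f g :: "complex \<Rightarrow> complex"
  have "(\<integral>z. g z * cnj (f z) \<partial>haar) = (\<integral>z. cnj (f z * cnj (g z)) \<partial>haar)"
    by (simp add: mult.commute)
  also have "\<dots> = cnj (\<integral>z. f z * cnj (g z) \<partial>haar)"
    by (rule Bochner_Integration.integral_cnj)
  finally show "(\<integral>z. g z * cnj (f z) \<partial>haar) = cnj (\<integral>z. f z * cnj (g z) \<partial>haar)" .
qed

lemma cinner_add_left: "cinner (f + g) h = cinner f h + cinner g h"
  by transfer (simp add: l2_rel_def distrib_right square_integrable_mult_cnj)

lemma cinner_scaleC_left: "cinner (c *\<^sub>C f) g = c * cinner f g"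
  by transfer (simp add: mult.assoc)

lemma cinner_add_right: "cinner h (f + g) = cinner h f + cinner h g"
  unfolding cinner_commute[of h] by (simp add: cinner_add_left)

lemma cinner_scaleC_right: "cinner f (c *\<^sub>C g) = cnj c * cinner f g"
  unfolding cinner_commute[of f] by (simp add: cinner_scaleC_left)

lemma uminus_eq_scaleC: "- f = (- 1) *\<^sub>C (f :: l2_circle)"
  by (rule uminus_l2_circle_def)

lemma cinner_diff_left: "cinner (f - g) h = cinner f h - cinner g h"
  by (simp only: diff_conv_add_uminus cinner_add_left uminus_eq_scaleC cinner_scaleC_left) simp

lemma cinner_diff_right: "cinner h (f - g) = cinner h f - cinner h g"
  unfolding cinner_commute[of h] by (simp add: cinner_diff_left)

lemma cinner_zero_left [simp]: "cinner 0 f = 0"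
  using cinner_diff_left[of 0 0 f] by simp

lemma cinner_zero_right [simp]: "cinner f 0 = 0"
  using cinner_diff_right[of f 0 0] by simp

lemma cinner_self: "cinner f f = of_real ((norm f)\<^sup>2)"
proof -
  have "Im (cinner f f) = 0"
    using arg_cong[OF cinner_commute[of f f], of Im] by simp
  then show ?thesis
    by (simp add: complex_eq_iff power2_norm_eq_inner inner_l2_circle_def)
qed

lemma cinner_self_eq_0_iff: "cinner f f = 0 \<longleftrightarrow> f = 0"
  by (simp add: cinner_self)

lemma l2_circle_eqI:
  assumes "\<And>h. cinner h f = cinner h g"
  shows "f = g"
proof -
  have "cinner (f - g) (f - g) = 0"
    by (simp add: cinner_diff_right assms)
  then show ?thesis
    by (simp add: cinner_self_eq_0_iff)
qed

lemma norm_scaleC: "norm (c *\<^sub>C f) = cmod c * norm f"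
proof (rule power2_eq_imp_eq)
  have "complex_of_real ((norm (c *\<^sub>C f))\<^sup>2) = cnj c * (c * cinner f f)"
    by (simp only: cinner_self[symmetric] cinner_scaleC_left cinner_scaleC_right)
  also have "\<dots> = of_real ((cmod c * norm f)\<^sup>2)"
    by (simp only: cinner_self of_real_mult power_mult_distrib complex_norm_square) (simp add: mult_ac)
  finally show "(norm (c *\<^sub>C f))\<^sup>2 = (cmod c * norm f)\<^sup>2"
    by (simp only: of_real_eq_iff)
qed simp_all

lemma scaleC_add_left: "(a + b) *\<^sub>C f = a *\<^sub>C f + b *\<^sub>C f"
  by (rule l2_circle_eqI) (simp add: cinner_add_right cinner_scaleC_right algebra_simps)

lemma scaleC_add_right: "a *\<^sub>C (f + g) = a *\<^sub>C f + a *\<^sub>C g"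
  by (rule l2_circle_eqI) (simp add: cinner_add_right cinner_scaleC_right algebra_simps)

lemma scaleC_diff_left: "(a - b) *\<^sub>C f = a *\<^sub>C f - b *\<^sub>C f"
  by (rule l2_circle_eqI) (simp add: cinner_diff_right cinner_scaleC_right algebra_simps)

lemma scaleC_scaleC: "a *\<^sub>C b *\<^sub>C f = (a * b) *\<^sub>C f"
  by (rule l2_circle_eqI) (simp add: cinner_scaleC_right)

lemma scaleC_one [simp]: "1 *\<^sub>C f = f"
  by (rule l2_circle_eqI) (simp add: cinner_scaleC_right)

lemma scaleC_zero_left [simp]: "0 *\<^sub>C f = 0"
  by (rule l2_circle_eqI) (simp add: cinner_scaleC_right)

lemma scaleC_sum_right: "c *\<^sub>C (\<Sum>k\<in>A. f k) = (\<Sum>k\<in>A. c *\<^sub>C f k)"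
proof (induction A rule: infinite_finite_induct)
  case (insert x F)
  then show ?case by (simp add: scaleC_add_right)
qed (rule l2_circle_eqI, simp add: cinner_scaleC_right)+

lemma cinner_sum_left: "cinner (\<Sum>k\<in>A. f k) g = (\<Sum>k\<in>A. cinner (f k) g)"
  by (induction A rule: infinite_finite_induct) (simp_all add: cinner_add_left)

text \<open>The real inner product bounds only the real part; rotating one vector moves the whole
  modulus there.\<close>

lemma cinner_Cauchy_Schwarz: "cmod (cinner f g) \<le> norm f * norm g"
proof (cases "cinner f g = 0")
  case False
  define c where "c = cnj (cinner f g) / of_real (cmod (cinner f g))"
  have c: "cmod c = 1"
    using False by (simp add: c_def norm_divide)
  have "c * cinner f g = of_real (cmod (cinner f g))"
    using False by (simp add: c_def complex_norm_square[symmetric] power2_eq_square divide_simps mult_ac)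
  then have "cmod (cinner f g) = inner (c *\<^sub>C f) g"
    by (simp add: inner_l2_circle_def cinner_scaleC_left)
  also have "\<dots> \<le> norm (c *\<^sub>C f) * norm g"
    by (rule norm_cauchy_schwarz)
  finally show ?thesis
    by (simp add: norm_scaleC c)
qed simp

text \<open>Adjoints are handled as pairs of operators because \<open>cadjoint\<close> is a definite description,
  which has a meaning only after an adjoint has been exhibited.\<close>

definition adjoint_pair :: "(l2_circle \<Rightarrow> l2_circle) \<Rightarrow> (l2_circle \<Rightarrow> l2_circle) \<Rightarrow> bool" where
  "adjoint_pair T A \<longleftrightarrow> (\<forall>f g. cinner (T f) g = cinner f (A g))"

lemma cadjoint_eq:
  assumes "adjoint_pair T A"
  shows "cadjoint T = A"
  unfolding cadjoint_def
proof (rule the_equality)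
  show "\<forall>f g. cinner (T f) g = cinner f (A g)"
    using assms by (simp add: adjoint_pair_def)
next
  fix B
  assume B: "\<forall>f g. cinner (T f) g = cinner f (B g)"
  then show "B = A"
    using assms by (intro ext l2_circle_eqI) (simp add: adjoint_pair_def)
qed

lemma adjoint_pair_swap: "adjoint_pair T A \<Longrightarrow> adjoint_pair A T"
  unfolding adjoint_pair_def by (subst (1 2) cinner_commute) simp

lemma adjoint_pair_comp:
  assumes "adjoint_pair T A" "adjoint_pair U B"
  shows "adjoint_pair (T \<circ> U) (B \<circ> A)"
  using assms by (simp add: adjoint_pair_def)

lemma adjoint_pair_cinner: "adjoint_pair T A \<Longrightarrow> cinner f (A g) = cinner (T f) g"
  by (simp add: adjoint_pair_def)

lemma adjoint_pair_add: "adjoint_pair T A \<Longrightarrow> A (f + g) = A f + A g"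
  by (rule l2_circle_eqI) (simp add: adjoint_pair_cinner cinner_add_right)

lemma adjoint_pair_scaleC: "adjoint_pair T A \<Longrightarrow> A (c *\<^sub>C f) = c *\<^sub>C A f"
  by (rule l2_circle_eqI) (simp add: adjoint_pair_cinner cinner_scaleC_right)

lemma adjoint_pair_zero:
  assumes "adjoint_pair T A"
  shows "A 0 = 0"
  using adjoint_pair_add[OF assms, of 0 0] by simp

lemma adjoint_pair_sum:
  assumes "adjoint_pair T A"
  shows "A (\<Sum>k\<in>K. f k) = (\<Sum>k\<in>K. A (f k))"
  by (induction K rule: infinite_finite_induct)
    (simp_all add: adjoint_pair_add[OF assms] adjoint_pair_zero[OF assms])

context
  fixes Q
  assumes Q: "orthogonal_projection Q"
begin

lemma projection_self_adjoint: "adjoint_pair Q Q"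
  using Q by (simp add: orthogonal_projection_def adjoint_pair_def)

lemma projection_idem: "Q (Q f) = Q f"
  using Q by (simp add: orthogonal_projection_def fun_eq_iff)

lemma projection_diff: "Q (f - g) = Q f - Q g"
  using adjoint_pair_add[OF projection_self_adjoint, of "f - g" g, symmetric]
  by (simp add: eq_diff_eq)

lemma norm_projection_sq: "complex_of_real ((norm (Q f))\<^sup>2) = cinner (Q f) f"
proof -
  have "cinner (Q f) (Q f) = cinner (Q (Q f)) f"
    using projection_self_adjoint by (simp add: adjoint_pair_def)
  then show ?thesis
    by (simp only: projection_idem cinner_self)
qed

lemma projection_Pythagoras: "(norm f)\<^sup>2 = (norm (Q f))\<^sup>2 + (norm (f - Q f))\<^sup>2"
proof -
  have "cinner (Q f) (f - Q f) = 0"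
    by (simp add: cinner_diff_right norm_projection_sq[symmetric] cinner_self)
  then have "inner (Q f) (f - Q f) = 0"
    by (simp add: inner_l2_circle_def)
  then have "(norm (Q f + (f - Q f)))\<^sup>2 = (norm (Q f))\<^sup>2 + (norm (f - Q f))\<^sup>2"
    by (simp only: norm_add_Pythagorean[unfolded orthogonal_def])
  then show ?thesis by simp
qed

lemma norm_projection_le: "norm (Q f) \<le> norm f"
proof (rule power2_le_imp_le)
  show "(norm (Q f))\<^sup>2 \<le> (norm f)\<^sup>2"
    by (simp add: projection_Pythagoras[of f])
qed simp

text \<open>By the theorem of Pythagoras a vector whose norm does not drop has no component in the
  kernel.\<close>

lemma projection_fixed:
  assumes "norm f \<le> norm (Q f)"
  shows "Q f = f"
proof -
  have "(norm f)\<^sup>2 \<le> (norm (Q f))\<^sup>2"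
    using assms by (intro power_mono) auto
  then have "(norm (f - Q f))\<^sup>2 \<le> 0"
    using projection_Pythagoras[of f] by linarith
  then show ?thesis by simp
qed

lemma continuous_on_projection: "continuous_on A Q"
proof (rule lipschitz_on_continuous_on[of 1])
  show "1-lipschitz_on A Q"
  proof (rule lipschitz_onI)
    show "dist (Q f) (Q g) \<le> 1 * dist f g" for f g
      by (simp add: dist_norm norm_projection_le flip: projection_diff)
  qed simp
qed

end


section \<open>Haar measure and the averages over roots\<close>

lemma measurable_cis_unit_interval:
  "(\<lambda>t. cis (2 * pi * t)) \<in> measurable (restrict_space lborel {0..<1::real}) (restrict_space borel circle)"
proof (rule measurable_restrict_space2)
  have "(\<lambda>t. cis (2 * pi * t)) \<in> borel_measurable borel"
    by (intro borel_measurable_continuous_onI continuous_intros)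
  then show "(\<lambda>t. cis (2 * pi * t)) \<in> borel_measurable (restrict_space lborel {0..<1::real})"
    by (intro measurable_restrict_space1) simp
qed auto

lemma space_haar [simp]: "space haar = circle"
  by (simp add: haar_def space_restrict_space)

lemma sets_haar: "sets haar = sets (restrict_space borel circle)"
  by (simp add: haar_def)

lemma prob_space_haar: "finite_measure haar" "measure haar circle = 1"
proof -
  have "emeasure haar circle = emeasure lborel {0..<1::real}"
    unfolding haar_def
    by (subst emeasure_distr[OF measurable_cis_unit_interval])
      (auto simp: sets_restrict_space emeasure_restrict_space space_restrict_space vimage_def
        intro!: arg_cong[where f = "emeasure lborel"])
  then have e: "emeasure haar circle = 1" by simp
  then show "finite_measure haar" by (intro finite_measureI) simp
  show "measure haar circle = 1" using e by (simp add: measure_def)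
qed

interpretation haar: finite_measure haar
  by (rule prob_space_haar)

lemma measurable_haar_borel:
  assumes "f \<in> borel_measurable borel"
  shows "f \<in> borel_measurable haar"
  using measurable_restrict_space1[OF assms, of circle] by (simp add: measurable_cong_sets[OF sets_haar refl])

lemma measurable_haar_continuous:
  assumes "continuous_on circle f"
  shows "f \<in> borel_measurable haar"
  using borel_measurable_continuous_on_restrict[OF assms]
  by (simp add: measurable_cong_sets[OF sets_haar refl])

lemma measurable_to_haar:
  assumes "f \<in> borel_measurable M" "\<And>z. z \<in> space M \<Longrightarrow> f z \<in> circle"
  shows "f \<in> measurable M haar"
  unfolding measurable_cong_sets[OF refl sets_haar]
  using assms by (intro measurable_restrict_space2) auto

lemma
  fixes f :: "complex \<Rightarrow> 'b::{banach, second_countable_topology}"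
  assumes "f \<in> borel_measurable haar"
  shows integral_haar:
      "(\<integral>z. f z \<partial>haar) = (\<integral>t. indicator {0..<1::real} t *\<^sub>R f (cis (2 * pi * t)) \<partial>lborel)"
    and integrable_haar_iff:
      "integrable haar f \<longleftrightarrow> integrable lborel (\<lambda>t. indicator {0..<1::real} t *\<^sub>R f (cis (2 * pi * t)))"
proof -
  have f: "f \<in> borel_measurable (restrict_space borel circle)"
    using assms by (simp add: measurable_cong_sets[OF sets_haar refl])
  show "(\<integral>z. f z \<partial>haar) = (\<integral>t. indicator {0..<1::real} t *\<^sub>R f (cis (2 * pi * t)) \<partial>lborel)"
    unfolding haar_def integral_distr[OF measurable_cis_unit_interval f]
    by (rule integral_restrict_space) simp
  show "integrable haar f \<longleftrightarrow> integrable lborel (\<lambda>t. indicator {0..<1::real} t *\<^sub>R f (cis (2 * pi * t)))"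
    unfolding haar_def integrable_distr_eq[OF measurable_cis_unit_interval f]
    by (rule integrable_restrict_space) simp
qed

text \<open>This parametrization turns a sum over \<open>N\<close>-th roots into a sum over \<open>N\<close> translated and
  rescaled copies of the unit interval.\<close>

lemma roots_cis:
  assumes "N > 0"
  shows "bij_betw (\<lambda>j. cis (2 * pi * (t + real j) / real N)) {..<N} {w. w ^ N = cis (2 * pi * t)}"
proof -
  have inj: "inj_on (\<lambda>j. cis (2 * pi * (t + real j) / real N)) {..<N}"
  proof (rule inj_onI)
    fix i j
    assume ij: "i \<in> {..<N}" "j \<in> {..<N}"
      and "cis (2 * pi * (t + real i) / real N) = cis (2 * pi * (t + real j) / real N)"
    then have "cis (2 * pi * t / N) * cis (2 * pi * real i / N)
      = cis (2 * pi * t / N) * cis (2 * pi * real j / N)"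
      by (simp add: cis_mult add_divide_distrib distrib_left)
    then have "cis (2 * pi * real i / N) = cis (2 * pi * real j / N)"
      by simp
    then show "i = j"
      using Complex.bij_betw_roots_unity[OF assms] ij by (auto simp: bij_betw_def inj_on_def)
  qed
  have sub: "(\<lambda>j. cis (2 * pi * (t + real j) / real N)) ` {..<N} \<subseteq> {w. w ^ N = cis (2 * pi * t)}"
  proof clarsimp
    fix j
    have "real N * (2 * pi * (t + real j) / real N) = 2 * pi * t + 2 * pi * real j"
      using assms by (simp add: field_simps)
    then have "cis (2 * pi * (t + real j) / real N) ^ N = cis (2 * pi * t + 2 * pi * real j)"
      by (simp only: Complex.DeMoivre)
    also have "\<dots> = cis (2 * pi * t)"
      by (simp add: cis_mult[symmetric] cis_multiple_2pi)
    finally show "cis (2 * pi * (t + real j) / real N) ^ N = cis (2 * pi * t)"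
      by simp
  qed
  have "card {w. w ^ N = cis (2 * pi * t)} = card ((\<lambda>j. cis (2 * pi * (t + real j) / real N)) ` {..<N})"
    using card_image[OF inj] card_nth_roots[of "cis (2 * pi * t)" N] assms by simp
  then have "(\<lambda>j. cis (2 * pi * (t + real j) / real N)) ` {..<N} = {w. w ^ N = cis (2 * pi * t)}"
    by (intro card_subset_eq sub finite_nth_roots assms) simp
  with inj show ?thesis by (simp add: bij_betw_def)
qed

lemma roots_in_circle: "N > 0 \<Longrightarrow> z \<in> circle \<Longrightarrow> w ^ N = z \<Longrightarrow> w \<in> circle"
  using power_eq_imp_eq_base[of "cmod w" N 1] by (auto simp: norm_power)

lemma Arg_measurable: "Arg \<in> borel_measurable borel"
proof -
  have *: "Arg = (\<lambda>x. if x \<in> - \<real>\<^sub>\<le>\<^sub>0 then Arg x else if x = 0 then 0 else pi)"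
  proof
    fix x
    have "Arg x = pi" if "x \<noteq> 0" "x \<in> \<real>\<^sub>\<le>\<^sub>0"
      using that by (auto simp: Arg_eq_pi complex_nonpos_Reals_iff complex_eq_iff)
    then show "Arg x = (if x \<in> - \<real>\<^sub>\<le>\<^sub>0 then Arg x else if x = 0 then 0 else pi)"
      by (simp add: Arg_zero)
  qed
  have "(\<lambda>x. if x \<in> - \<real>\<^sub>\<le>\<^sub>0 then Arg x else pi) \<in> borel_measurable borel"
    by (rule borel_measurable_continuous_on_if)
      (auto intro: continuous_on_Arg borel_comp borel_closed closed_nonpos_Reals_complex)
  then have "(\<lambda>x. if x = 0 then 0 else if x \<in> - \<real>\<^sub>\<le>\<^sub>0 then Arg x else pi) \<in> borel_measurable borel"
    by (rule measurable_If[rotated]) simp_all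
  also have "(\<lambda>x. if x = 0 then 0 else if x \<in> - \<real>\<^sub>\<le>\<^sub>0 then Arg x else pi) = Arg"
    by (subst (2) *) (auto simp: fun_eq_iff)
  finally show ?thesis .
qed

text \<open>The principal argument gives a measurable choice of \<open>N\<close> branches of the root, which
  together enumerate the index set of the sum.\<close>

lemma measurable_root_sum:
  fixes F :: "complex \<Rightarrow> 'b::{second_countable_topology, topological_comm_monoid_add}"
  assumes F: "F \<in> borel_measurable haar" and N: "N > 0"
  shows "(\<lambda>z. \<Sum>w | w ^ N = z. F w) \<in> borel_measurable haar"
proof -
  define \<rho> where "\<rho> j z = cis (2 * pi * (Arg z / (2 * pi) + real j) / real N)" for j z
  have "\<rho> j \<in> borel_measurable borel" for j
  proof -
    have "(\<lambda>x. cis (2 * pi * (x / (2 * pi) + real j) / real N)) \<in> borel_measurable borel"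
      using N by (intro borel_measurable_continuous_onI continuous_intros) auto
    from measurable_compose[OF Arg_measurable this] show ?thesis
      by (simp add: \<rho>_def[abs_def])
  qed
  then have "\<rho> j \<in> measurable haar haar" for j
    by (intro measurable_to_haar measurable_haar_borel) (simp_all add: \<rho>_def)
  then have "(\<lambda>z. \<Sum>j<N. F (\<rho> j z)) \<in> borel_measurable haar"
    using F by (intro borel_measurable_sum) (rule measurable_compose)
  moreover have "(\<Sum>w | w ^ N = z. F w) = (\<Sum>j<N. F (\<rho> j z))" if "z \<in> space haar" for z
  proof -
    have "z = cis (2 * pi * (Arg z / (2 * pi)))"
      using that by (cases "z = 0") (simp_all add: cis_Arg Complex.sgn_eq)
    with sum.reindex_bij_betw[OF roots_cis[OF N, of "Arg z / (2 * pi)"], of F] show ?thesis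
      by (simp add: \<rho>_def)
  qed
  ultimately show ?thesis
    by (subst measurable_cong) assumption+
qed

text \<open>Integration over the circle is integration of the averages over \<open>N\<close>-th roots: cut
  \<open>[0,1)\<close> into \<open>N\<close> equal intervals and rescale each of them to \<open>[0,1)\<close>.\<close>

lemma root_average:
  fixes F :: "complex \<Rightarrow> 'b::{banach, second_countable_topology}"
  assumes F: "integrable haar F" and N: "N > 0"
  shows "integrable haar (\<lambda>z. \<Sum>w | w ^ N = z. F w)"
    and "(\<integral>z. (\<Sum>w | w ^ N = z. F w) \<partial>haar) = real N *\<^sub>R (\<integral>z. F z \<partial>haar)"
proof -
  define G where "G j t = indicator {real j / N ..< (real j + 1) / N} t *\<^sub>R F (cis (2 * pi * t))"
    for j :: nat and t :: real
  have Fm: "F \<in> borel_measurable haar"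
    using F by simp
  have I: "integrable lborel (\<lambda>t. indicator {0..<1::real} t *\<^sub>R F (cis (2 * pi * t)))"
    using F integrable_haar_iff[OF Fm] by simp
  have in_unit: "0 \<le> t \<and> t < 1" if "j < N" "real j / N \<le> t" "t < (real j + 1) / N" for j t
  proof -
    have "0 \<le> real j / N" "(real j + 1) / N \<le> 1"
      using that N by (auto simp: field_simps)
    with that show ?thesis by linarith
  qed
  have IG: "integrable lborel (G j)" if "j < N" for j
  proof -
    have "integrable lborel (\<lambda>t. indicator {real j / N ..< (real j + 1) / N} t *\<^sub>R
        (indicator {0..<1::real} t *\<^sub>R F (cis (2 * pi * t))))"
      by (intro integrable_mult_indicator I) simp
    also have "(\<lambda>t. indicator {real j / N ..< (real j + 1) / N} t *\<^sub>R
        (indicator {0..<1::real} t *\<^sub>R F (cis (2 * pi * t)))) = G j"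
      using in_unit[OF that] by (auto simp: G_def indicator_def fun_eq_iff)
    finally show ?thesis .
  qed
  have Gaff: "G j (real j / N + s / N) =
      indicator {0..<1} s *\<^sub>R F (cis (2 * pi * (s + real j) / N))" for j s
  proof -
    have "real j / N + s / N = (s + real j) / N"
      by (simp add: add_divide_distrib)
    moreover have "(s + real j) / N \<in> {real j / N ..< (real j + 1) / N} \<longleftrightarrow> s \<in> {0..<1}"
      using N by (auto simp: divide_le_cancel divide_less_cancel)
    ultimately show ?thesis
      by (simp add: G_def indicator_def)
  qed
  have IGaff: "integrable lborel (\<lambda>s. indicator {0..<1} s *\<^sub>R F (cis (2 * pi * (s + real j) / N)))"
    if "j < N" for j
    using lborel_integrable_real_affine[OF IG[OF that], of "1 / N" "real j / N"] N
    by (simp add: Gaff)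
  have sum_eq: "indicator {0..<1::real} t *\<^sub>R (\<Sum>w | w ^ N = cis (2 * pi * t). F w) =
      (\<Sum>j<N. indicator {0..<1} t *\<^sub>R F (cis (2 * pi * (t + real j) / N)))" for t
    using sum.reindex_bij_betw[OF roots_cis[OF N, of t], of F]
    by (simp only: scaleR_sum_right[symmetric])
  have Hm: "(\<lambda>z. \<Sum>w | w ^ N = z. F w) \<in> borel_measurable haar"
    by (rule measurable_root_sum[OF Fm N])
  show "integrable haar (\<lambda>z. \<Sum>w | w ^ N = z. F w)"
    unfolding integrable_haar_iff[OF Hm] sum_eq
    by (intro Bochner_Integration.integrable_sum IGaff) simp
  have split: "indicator {0..<1::real} t *\<^sub>R F (cis (2 * pi * t)) = (\<Sum>j<N. G j t)" for t
  proof (cases "t \<in> {0..<1}")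
    case False
    then show ?thesis
      using in_unit by (intro sym[OF trans[OF sum.neutral]]) (auto simp: G_def indicator_def)
  next
    case True
    \<comment> \<open>Exactly one of the \<open>N\<close> intervals contains \<open>t\<close>.\<close>
    define i where "i = nat \<lfloor>t * N\<rfloor>"
    have iff: "t \<in> {real j / N ..< (real j + 1) / N} \<longleftrightarrow> j = i" for j
    proof -
      have "t \<in> {real j / N ..< (real j + 1) / N} \<longleftrightarrow> of_int (int j) \<le> t * N \<and> t * N < of_int (int j) + 1"
        using N by (simp add: field_simps)
      also have "\<dots> \<longleftrightarrow> \<lfloor>t * N\<rfloor> = int j"
        by (simp only: floor_eq_iff)
      also have "\<dots> \<longleftrightarrow> j = i"
        using True by (auto simp: i_def)
      finally show ?thesis .
    qed
    have "i < N"
      using True N unfolding i_def by (simp add: nat_less_iff floor_less_iff)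
    then have "(\<Sum>j<N. G j t) = F (cis (2 * pi * t))"
      unfolding G_def indicator_def iff
      by (simp add: of_bool_def if_distrib[of "\<lambda>c. c *\<^sub>R _"] cong: if_cong)
    with True show ?thesis by simp
  qed
  have "(\<integral>z. F z \<partial>haar) = (\<Sum>j<N. \<integral>t. G j t \<partial>lborel)"
    unfolding integral_haar[OF Fm] split
    by (intro Bochner_Integration.integral_sum IG) simp
  also have "\<dots> = (\<Sum>j<N. (1 / N) *\<^sub>R (\<integral>s. indicator {0..<1} s *\<^sub>R F (cis (2 * pi * (s + real j) / N)) \<partial>lborel))"
  proof (rule sum.cong[OF refl])
    fix j
    show "(\<integral>t. G j t \<partial>lborel)
      = (1 / N) *\<^sub>R (\<integral>s. indicator {0..<1} s *\<^sub>R F (cis (2 * pi * (s + real j) / N)) \<partial>lborel)"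
      using lborel_integral_real_affine[of "1 / N" "G j" "real j / N"] N by (simp add: Gaff)
  qed
  also have "\<dots> = (1 / N) *\<^sub>R (\<integral>z. (\<Sum>w | w ^ N = z. F w) \<partial>haar)"
    unfolding integral_haar[OF Hm] sum_eq
    by (subst Bochner_Integration.integral_sum) (auto intro: IGaff simp: scaleR_sum_right)
  finally show "(\<integral>z. (\<Sum>w | w ^ N = z. F w) \<partial>haar) = real N *\<^sub>R (\<integral>z. F z \<partial>haar)"
    using N by simp
qed


section \<open>Fourier series on the circle\<close>

lemma sum_roots_powi:
  assumes N: "N > 0" and z: "z \<in> circle"
  shows "(\<Sum>w | w ^ N = z. w powi l) = (if int N dvd l then of_nat N * z powi (l div int N) else 0)"
proof (cases "int N dvd l")
  case True
  have z0: "z \<noteq> 0" using z by auto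
  have "w powi l = z powi (l div int N)" if "w ^ N = z" for w
  proof -
    have "w powi l = w powi (int N * (l div int N))"
      using True by simp
    also have "\<dots> = (w ^ N) powi (l div int N)"
      by (simp only: power_int_mult power_int_of_nat)
    finally show ?thesis by (simp add: that)
  qed
  then have "(\<Sum>w | w ^ N = z. w powi l) = (\<Sum>w | w ^ N = z. z powi (l div int N))"
    by (intro sum.cong) auto
  with True show ?thesis
    by (simp add: card_nth_roots[OF z0 N])
next
  case False
  \<comment> \<open>Rotation by a primitive root of unity permutes the roots and multiplies the sum by
    \<open>\<zeta> powi l \<noteq> 1\<close>.\<close>
  define \<zeta> where "\<zeta> = cis (2 * pi / real N)"
  have \<zeta>: "\<zeta> \<noteq> 0" "\<zeta> ^ N = 1"
    using N by (simp_all add: \<zeta>_def Complex.DeMoivre)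
  have "\<zeta> powi l \<noteq> 1"
  proof
    assume "\<zeta> powi l = 1"
    then have "cos (of_int l * (2 * pi / real N)) = 1"
      by (simp add: \<zeta>_def cis_power_int complex_eq_iff)
    then obtain n :: int where "of_int l * (2 * pi / real N) = of_int n * 2 * pi"
      by (auto simp: cos_one_2pi_int)
    then have "real_of_int l = of_int (n * int N)"
      using N by (simp add: field_simps)
    then have "l = n * int N"
      by (simp only: of_int_eq_iff)
    with False show False by simp
  qed
  moreover have "bij_betw (\<lambda>w. \<zeta> * w) {w. w ^ N = z} {w. w ^ N = z}"
    by (rule bij_betwI[of _ _ _ "\<lambda>w. w / \<zeta>"])
      (use \<zeta> in \<open>auto simp: power_mult_distrib power_divide\<close>)
  then have "(\<Sum>w | w ^ N = z. w powi l) = (\<Sum>w | w ^ N = z. (\<zeta> * w) powi l)"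
    by (rule sum.reindex_bij_betw[symmetric])
  then have "(\<Sum>w | w ^ N = z. w powi l) = \<zeta> powi l * (\<Sum>w | w ^ N = z. w powi l)"
    by (simp only: power_int_mult_distrib sum_distrib_left[symmetric])
  ultimately show ?thesis
    using False by simp
qed

lemma continuous_on_powi: "continuous_on circle (\<lambda>z. z powi k)"
  by (intro continuous_intros) auto

lemma continuous_on_circle_bounded:
  fixes f :: "complex \<Rightarrow> 'b::real_normed_vector"
  assumes "continuous_on circle f"
  shows "\<exists>B. \<forall>z\<in>circle. norm (f z) \<le> B"
proof -
  have "bounded (f ` circle)"
    by (intro compact_imp_bounded compact_continuous_image assms) simp
  then show ?thesis
    by (simp add: bounded_iff)
qed

lemma square_integrable_mult_bounded:
  assumes g: "continuous_on circle g" and f: "square_integrable haar f"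
  shows "square_integrable haar (\<lambda>z. g z * f z)"
proof -
  obtain B where B: "\<And>z. z \<in> circle \<Longrightarrow> norm (g z) \<le> B"
    using continuous_on_circle_bounded[OF g] by blast
  have [measurable]: "f \<in> borel_measurable haar" "g \<in> borel_measurable haar"
    using f measurable_haar_continuous[OF g] by (auto simp: square_integrable_def)
  have "integrable haar (\<lambda>z. B\<^sup>2 * (cmod (f z))\<^sup>2)"
    using f by (simp add: square_integrable_def)
  then have "integrable haar (\<lambda>z. (cmod (g z * f z))\<^sup>2)"
  proof (rule Bochner_Integration.integrable_bound)
    show "AE z in haar. norm ((cmod (g z * f z))\<^sup>2) \<le> norm (B\<^sup>2 * (cmod (f z))\<^sup>2)"
      using B by (intro AE_I2) (auto simp: norm_mult power_mult_distrib intro!: mult_right_mono power_mono)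
  qed simp
  then show ?thesis by (simp add: square_integrable_def)
qed

lemma square_integrable_one: "square_integrable haar (\<lambda>z. 1)"
  by (simp add: square_integrable_def)

lemma square_integrable_continuous: "continuous_on circle g \<Longrightarrow> square_integrable haar g"
  using square_integrable_mult_bounded[OF _ square_integrable_one] by simp

lemma square_integrable_integrable: "square_integrable haar f \<Longrightarrow> integrable haar f"
  using square_integrable_mult_cnj[OF _ square_integrable_one] by simp

lemma abs_l2_circle_eqI:
  assumes "square_integrable haar f" "square_integrable haar g" "AE z in haar. f z = g z"
  shows "abs_l2_circle f = abs_l2_circle g"
  using assms Quotient3_rel[OF Quotient3_l2_circle, of f g] by (auto simp: l2_rel_def)

lemma abs_l2_circle_cong:
  assumes "square_integrable haar f" "square_integrable haar g" "\<And>z. z \<in> circle \<Longrightarrow> f z = g z"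
  shows "abs_l2_circle f = abs_l2_circle g"
  using assms by (intro abs_l2_circle_eqI AE_I2) auto

lemma abs_l2_circle_eqD:
  assumes "square_integrable haar f" "square_integrable haar g" "abs_l2_circle f = abs_l2_circle g"
  shows "AE z in haar. f z = g z"
  using assms Quotient3_rel[OF Quotient3_l2_circle, of f g] by (auto simp: l2_rel_def)

lemma square_integrable_rep: "square_integrable haar (rep_l2_circle f)"
  using Quotient3_rep_reflp[OF Quotient3_l2_circle, of f] by (simp add: l2_rel_def)

lemma abs_rep_l2_circle: "abs_l2_circle (rep_l2_circle f) = f"
  by (rule Quotient3_abs_rep[OF Quotient3_l2_circle])

lemma cinner_abs:
  assumes "square_integrable haar f" "square_integrable haar g"
  shows "cinner (abs_l2_circle f) (abs_l2_circle g) = (\<integral>z. f z * cnj (g z) \<partial>haar)"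
  using assms by (intro cinner.abs_eq) (auto simp: l2_rel_def)

lemma scaleC_abs:
  assumes "square_integrable haar f"
  shows "c *\<^sub>C abs_l2_circle f = abs_l2_circle (\<lambda>z. c * f z)"
  using assms by (intro scaleC.abs_eq) (auto simp: l2_rel_def)

lemma plus_abs:
  assumes "square_integrable haar f" "square_integrable haar g"
  shows "abs_l2_circle f + abs_l2_circle g = abs_l2_circle (\<lambda>z. f z + g z)"
  using assms by (intro plus_l2_circle.abs_eq) (auto simp: l2_rel_def)

lemma zero_abs: "0 = abs_l2_circle (\<lambda>z. 0)"
  by (simp add: zero_l2_circle_def)

lemma powi_add_mult:
  fixes z :: complex
  assumes "z \<noteq> 0"
  shows "z powi (k + int n * l) = z powi k * (z ^ n) powi l"
proof -
  have "z powi (k + int n * l) = z powi k * z powi (int n * l)"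
    by (rule power_int_add) (simp add: assms)
  also have "z powi (int n * l) = (z ^ n) powi l"
    by (simp only: power_int_mult power_int_of_nat)
  finally show ?thesis .
qed

definition fourier :: "int \<Rightarrow> l2_circle" where
  "fourier k = abs_l2_circle (\<lambda>z. z powi k)"

lemma square_integrable_powi: "square_integrable haar (\<lambda>z. z powi k)"
  by (intro square_integrable_continuous continuous_on_powi)

lemma cnj_circle: "z \<in> circle \<Longrightarrow> cnj z = inverse z"
  using complex_norm_square[of z] by (intro inverse_unique[symmetric]) simp

lemma cnj_powi_circle: "z \<in> circle \<Longrightarrow> cnj (z powi k) = z powi (- k)"
  by (simp add: cnj_circle power_int_minus power_int_inverse complex_cnj_power_int)

lemma integral_powi: "(\<integral>z. z powi k \<partial>haar) = (if k = 0 then 1 else 0)"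
proof (cases "k = 0")
  case True
  then show ?thesis by (simp add: prob_space_haar)
next
  case False
  \<comment> \<open>For \<open>N > \<bar>k\<bar>\<close> the average of \<open>w powi k\<close> over the \<open>N\<close>-th roots already vanishes.\<close>
  define N where "N = nat \<bar>k\<bar> + 1"
  have N: "N > 0" and "\<not> int N dvd k"
    using False zdvd_not_zless[of "\<bar>k\<bar>" "int N"] by (auto simp: N_def)
  have "real N *\<^sub>R (\<integral>z. z powi k \<partial>haar) = (\<integral>z. (\<Sum>w | w ^ N = z. w powi k) \<partial>haar)"
    by (intro root_average(2)[symmetric] square_integrable_integrable square_integrable_powi N)
  also have "\<dots> = (\<integral>z. 0 \<partial>haar)"
    using \<open>\<not> int N dvd k\<close> by (intro Bochner_Integration.integral_cong refl) (simp add: sum_roots_powi[OF N])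
  finally show ?thesis
    using N False by simp
qed

lemma cinner_fourier: "cinner (fourier k) (fourier l) = (if k = l then 1 else 0)"
proof -
  have "cinner (fourier k) (fourier l) = (\<integral>z. z powi k * cnj (z powi l) \<partial>haar)"
    by (simp add: fourier_def cinner_abs square_integrable_powi)
  also have "\<dots> = (\<integral>z. z powi (k - l) \<partial>haar)"
  proof (intro Bochner_Integration.integral_cong refl)
    fix z assume "z \<in> space haar"
    then have "z \<in> circle" "z \<noteq> 0" by auto
    then show "z powi k * cnj (z powi l) = z powi (k - l)"
      by (simp only: cnj_powi_circle power_int_add[symmetric] simp_thms) simp
  qed
  also have "\<dots> = (if k = l then 1 else 0)"
    by (simp add: integral_powi)
  finally show ?thesis .
qed

lemma norm_fourier [simp]: "norm (fourier k) = 1"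
proof -
  have "complex_of_real ((norm (fourier k))\<^sup>2) = 1"
    by (simp only: cinner_self[symmetric] cinner_fourier simp_thms if_True)
  then have "(norm (fourier k))\<^sup>2 = 1"
    by (simp only: of_real_eq_1_iff)
  then show ?thesis
    using norm_ge_zero[of "fourier k"] by (simp add: power2_eq_1_iff)
qed

lemma trigonometric_polynomial_monom: "trigonometric_polynomial (\<lambda>z. a * z powi k)"
  unfolding trigonometric_polynomial_def
  by (intro exI[of _ "{k}"] exI[of _ "\<lambda>_. a"]) simp

lemma trigonometric_polynomial_add:
  assumes "trigonometric_polynomial f" "trigonometric_polynomial g"
  shows "trigonometric_polynomial (\<lambda>z. f z + g z)"
proof -
  obtain K c L d where K: "finite K" "\<And>z. z \<in> circle \<Longrightarrow> f z = (\<Sum>k\<in>K. c k * z powi k)"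
    and L: "finite L" "\<And>z. z \<in> circle \<Longrightarrow> g z = (\<Sum>k\<in>L. d k * z powi k)"
    using assms unfolding trigonometric_polynomial_def by metis
  have "f z + g z = (\<Sum>k\<in>K \<union> L. ((if k \<in> K then c k else 0) + (if k \<in> L then d k else 0)) * z powi k)"
    if "z \<in> circle" for z
  proof -
    have "(\<Sum>k\<in>K \<union> L. (if k \<in> K then c k else 0) * z powi k) = (\<Sum>k\<in>K. c k * z powi k)"
      using K(1) L(1) by (intro sum.mono_neutral_cong_right) auto
    moreover have "(\<Sum>k\<in>K \<union> L. (if k \<in> L then d k else 0) * z powi k) = (\<Sum>k\<in>L. d k * z powi k)"
      using K(1) L(1) by (intro sum.mono_neutral_cong_right) auto
    ultimately show ?thesis
      using K(2) L(2) that by (simp only: distrib_right sum.distrib)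
  qed
  then show ?thesis
    using K(1) L(1) unfolding trigonometric_polynomial_def
    by (intro exI[of _ "K \<union> L"] exI) auto
qed

lemma trigonometric_polynomial_sum:
  "(\<And>k. k \<in> K \<Longrightarrow> trigonometric_polynomial (f k)) \<Longrightarrow> trigonometric_polynomial (\<lambda>z. \<Sum>k\<in>K. f k z)"
proof (induction K rule: infinite_finite_induct)
  case (insert x F)
  then show ?case by (simp add: trigonometric_polynomial_add)
qed (use trigonometric_polynomial_monom[of 0 0] in simp_all)

lemma trigonometric_polynomial_cong:
  assumes "trigonometric_polynomial f" "\<And>z. z \<in> circle \<Longrightarrow> f z = g z"
  shows "trigonometric_polynomial g"
  using assms unfolding trigonometric_polynomial_def by metis

lemma trigonometric_polynomial_mult:
  assumes "trigonometric_polynomial f" "trigonometric_polynomial g"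
  shows "trigonometric_polynomial (\<lambda>z. f z * g z)"
proof -
  obtain K c L d where K: "finite K" "\<And>z. z \<in> circle \<Longrightarrow> f z = (\<Sum>k\<in>K. c k * z powi k)"
    and L: "finite L" "\<And>z. z \<in> circle \<Longrightarrow> g z = (\<Sum>k\<in>L. d k * z powi k)"
    using assms unfolding trigonometric_polynomial_def by metis
  have "trigonometric_polynomial (\<lambda>z. \<Sum>k\<in>K. \<Sum>l\<in>L. (c k * d l) * z powi (k + l))"
    by (intro trigonometric_polynomial_sum trigonometric_polynomial_monom)
  then show ?thesis
  proof (rule trigonometric_polynomial_cong)
    fix z assume z: "z \<in> circle"
    then have "z \<noteq> 0" by auto
    then show "(\<Sum>k\<in>K. \<Sum>l\<in>L. (c k * d l) * z powi (k + l)) = f z * g z"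
      by (simp add: K(2)[OF z] L(2)[OF z] sum_product power_int_add mult_ac)
  qed
qed

text \<open>On the circle \<open>Re z\<close> and \<open>Im z\<close> are combinations of \<open>z\<close> and \<open>z\<inverse>\<close>, so the
  Stone-Weierstrass theorem for polynomials in two real variables applies to trigonometric
  polynomials.\<close>

lemma real_polynomial_function_trigonometric:
  assumes "real_polynomial_function p"
  shows "trigonometric_polynomial (\<lambda>z. complex_of_real (p z))"
  using assms
proof induction
  case (linear f)
  interpret bounded_linear f by fact
  have "trigonometric_polynomial (\<lambda>z. (of_real (f 1) / 2 + of_real (f \<i>) / (2 * \<i>)) * z powi 1
      + (of_real (f 1) / 2 - of_real (f \<i>) / (2 * \<i>)) * z powi (-1))"
    by (intro trigonometric_polynomial_add trigonometric_polynomial_monom)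
  then show ?case
  proof (rule trigonometric_polynomial_cong)
    fix z :: complex assume z: "z \<in> circle"
    have "f z = f (Re z *\<^sub>R 1 + Im z *\<^sub>R \<i>)"
      by (rule arg_cong[of _ _ f]) (simp add: complex_eq_iff)
    also have "\<dots> = Re z * f 1 + Im z * f \<i>"
      by (simp only: add scaleR real_scaleR_def)
    finally show "(of_real (f 1) / 2 + of_real (f \<i>) / (2 * \<i>)) * z powi 1
      + (of_real (f 1) / 2 - of_real (f \<i>) / (2 * \<i>)) * z powi (-1) = complex_of_real (f z)"
      using z by (simp add: power_int_minus cnj_circle[symmetric] complex_eq_iff)
  qed
next
  case (const c)
  show ?case using trigonometric_polynomial_monom[of "of_real c" 0] by simp
next
  case (add f g)
  then show ?case by (simp add: trigonometric_polynomial_add)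
next
  case (mult f g)
  then show ?case by (simp add: trigonometric_polynomial_mult)
qed

context
  fixes g :: "complex \<Rightarrow> complex"
  assumes g: "integrable haar g" and zero: "\<And>k. (\<integral>z. g z * z powi k \<partial>haar) = 0"
begin

private lemma integrable_mult_continuous:
  assumes "continuous_on circle p"
  shows "integrable haar (\<lambda>z. g z * p z)"
proof -
  obtain B where B: "\<And>z. z \<in> circle \<Longrightarrow> norm (p z) \<le> B"
    using continuous_on_circle_bounded[OF assms] by blast
  have [measurable]: "g \<in> borel_measurable haar" "p \<in> borel_measurable haar"
    using g measurable_haar_continuous[OF assms] by auto
  have "integrable haar (\<lambda>z. B * cmod (g z))"
    using g by simp
  then show ?thesis
  proof (rule Bochner_Integration.integrable_bound)
    show "AE z in haar. norm (g z * p z) \<le> norm (B * cmod (g z))"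
    proof (rule AE_I2)
      fix z assume "z \<in> space haar"
      then have "cmod (p z) \<le> \<bar>B\<bar>" using B[of z] by simp
      then show "norm (g z * p z) \<le> norm (B * cmod (g z))"
        using mult_left_mono[of "cmod (p z)" "\<bar>B\<bar>" "cmod (g z)"] by (simp add: norm_mult mult.commute)
    qed
  qed simp
qed

private lemma integral_trigonometric_polynomial_zero:
  assumes "trigonometric_polynomial p"
  shows "(\<integral>z. g z * p z \<partial>haar) = 0"
proof -
  obtain K c where K: "finite K" "\<And>z. z \<in> circle \<Longrightarrow> p z = (\<Sum>k\<in>K. c k * z powi k)"
    using assms unfolding trigonometric_polynomial_def by metis
  have "(\<integral>z. g z * p z \<partial>haar) = (\<integral>z. (\<Sum>k\<in>K. c k * (g z * z powi k)) \<partial>haar)"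
    by (intro Bochner_Integration.integral_cong refl) (simp add: K(2) sum_distrib_left mult_ac)
  also have "\<dots> = (\<Sum>k\<in>K. \<integral>z. c k * (g z * z powi k) \<partial>haar)"
    by (intro Bochner_Integration.integral_sum integrable_mult_right integrable_mult_continuous continuous_on_powi)
  also have "\<dots> = 0"
    by (simp add: zero)
  finally show ?thesis .
qed

private lemma integral_continuous_zero:
  fixes \<phi> :: "complex \<Rightarrow> real"
  assumes \<phi>: "continuous_on circle \<phi>"
  shows "(\<integral>z. g z * of_real (\<phi> z) \<partial>haar) = 0"
proof -
  define C where "C = (\<integral>z. cmod (g z) \<partial>haar)"
  have C: "0 \<le> C" by (simp add: C_def)
  have \<phi>': "continuous_on circle (\<lambda>z. complex_of_real (\<phi> z))"
    by (intro continuous_intros \<phi>)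
  have small: "cmod (\<integral>z. g z * of_real (\<phi> z) \<partial>haar) \<le> e * C" if e: "0 < e" for e
  proof -
    obtain p where p: "real_polynomial_function p" "\<And>z. z \<in> circle \<Longrightarrow> \<bar>\<phi> z - p z\<bar> < e"
      using Stone_Weierstrass_real_polynomial_function[of circle \<phi> e] \<phi> e by auto
    have pc: "continuous_on circle (\<lambda>z. complex_of_real (p z))"
      using p(1) by (intro continuous_intros continuous_on_polymonial_function)
        (simp add: real_polynomial_function_eq)
    have i: "integrable haar (\<lambda>z. g z * of_real (\<phi> z))" "integrable haar (\<lambda>z. g z * of_real (p z))"
      by (intro integrable_mult_continuous \<phi>' pc)+
    have "(\<integral>z. g z * of_real (\<phi> z) \<partial>haar) = (\<integral>z. g z * of_real (\<phi> z) - g z * of_real (p z) \<partial>haar)"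
      using integral_trigonometric_polynomial_zero[OF real_polynomial_function_trigonometric[OF p(1)]]
      by (simp add: Bochner_Integration.integral_diff[OF i])
    also have "cmod \<dots> \<le> (\<integral>z. cmod (g z * of_real (\<phi> z) - g z * of_real (p z)) \<partial>haar)"
      by (rule integral_norm_bound)
    also have "\<dots> \<le> (\<integral>z. e * cmod (g z) \<partial>haar)"
    proof (rule integral_mono)
      fix z assume "z \<in> space haar"
      then have "cmod (of_real (\<phi> z - p z)) \<le> e"
        unfolding norm_of_real using p(2)[of z] by simp
      then show "cmod (g z * of_real (\<phi> z) - g z * of_real (p z)) \<le> e * cmod (g z)"
        unfolding right_diff_distrib[symmetric] of_real_diff[symmetric] norm_mult
        by (subst mult.commute) (intro mult_right_mono norm_ge_zero)
    qed (use g i in auto)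
    finally show ?thesis by (simp add: C_def)
  qed
  have "cmod (\<integral>z. g z * of_real (\<phi> z) \<partial>haar) \<le> 0"
  proof (rule field_le_epsilon)
    fix e :: real assume e: "0 < e"
    have "e / (C + 1) * C \<le> e"
      using C e by (simp add: field_simps)
    moreover have "0 < e / (C + 1)" using C e by simp
    ultimately show "cmod (\<integral>z. g z * of_real (\<phi> z) \<partial>haar) \<le> 0 + e"
      using small[of "e / (C + 1)"] by linarith
  qed
  then show ?thesis by simp
qed

text \<open>The indicator function of a closed set is the pointwise limit of the continuous functions
  \<open>max 0 (1 - n * infdist z A)\<close>.\<close>

private lemma integral_closed_zero:
  assumes A: "closed A"
  shows "(\<integral>z. g z * indicator A z \<partial>haar) = 0"
proof (cases "A = {}")
  case False
  define \<phi> where "\<phi> n z = max 0 (1 - real n * infdist z A)" for n and z :: complex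
  have \<phi>: "continuous_on circle (\<phi> n)" for n
    unfolding \<phi>_def by (intro continuous_intros)
  have [measurable]: "g \<in> borel_measurable haar" "\<phi> n \<in> borel_measurable haar"
    "indicat_real A \<in> borel_measurable haar" for n
    using g measurable_haar_continuous[OF \<phi>]
      measurable_haar_borel[OF borel_measurable_indicator[OF borel_closed[OF A]]] by auto
  have bound: "\<bar>\<phi> n z\<bar> \<le> 1" for n z
    using infdist_nonneg[of z A] by (auto simp: \<phi>_def)
  have lim: "(\<lambda>n. \<phi> n z) \<longlonglongrightarrow> indicator A z" for z
  proof (cases "z \<in> A")
    case True
    then show ?thesis by (simp add: \<phi>_def)
  next
    case not_in: False
    then have "0 < infdist z A"
      using A False by (metis in_closed_iff_infdist_zero infdist_nonneg le_less)
    then obtain n0 where n0: "1 < real n0 * infdist z A"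
      using reals_Archimedean3 by blast
    have "\<forall>\<^sub>F n in sequentially. 0 = \<phi> n z"
    proof (rule eventually_sequentiallyI[of n0])
      fix n assume "n0 \<le> n"
      then have "real n0 * infdist z A \<le> real n * infdist z A"
        by (intro mult_right_mono) (auto simp: infdist_nonneg)
      with n0 show "0 = \<phi> n z" by (simp add: \<phi>_def)
    qed
    with not_in show ?thesis
      by (simp add: tendsto_cong[of "\<lambda>_. 0", symmetric] tendsto_eventually eventually_mono)
  qed
  have "(\<lambda>n. \<integral>z. g z * of_real (\<phi> n z) \<partial>haar) \<longlonglongrightarrow> (\<integral>z. g z * of_real (indicator A z) \<partial>haar)"
  proof (rule integral_dominated_convergence[where w = "\<lambda>z. cmod (g z)"])
    show "AE z in haar. (\<lambda>n. g z * of_real (\<phi> n z)) \<longlonglongrightarrow> g z * of_real (indicator A z)"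
      by (intro AE_I2 tendsto_intros lim)
    show "AE z in haar. cmod (g z * of_real (\<phi> n z)) \<le> cmod (g z)" for n
      using bound[of n] by (intro AE_I2) (simp add: norm_mult mult_left_le)
  qed (use g in auto)
  then have "(\<lambda>n. 0) \<longlonglongrightarrow> (\<integral>z. g z * of_real (indicator A z) \<partial>haar)"
    by (simp add: integral_continuous_zero[OF \<phi>])
  then show ?thesis
    by (simp add: LIMSEQ_const_iff of_real_indicator)
qed simp

text \<open>The closed sets are an intersection-stable generator of the Borel sets, so \<open>g\<close> has integral
  \<open>0\<close> over every Borel set.\<close>

lemma zero_Fourier_coefficients_imp_AE_zero: "AE z in haar. g z = 0"
proof (rule haar.density_zero[OF g])
  have cap: "B \<inter> circle \<in> sets haar" if "B \<in> sets borel" for B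
    using that by (auto simp: sets_haar sets_restrict_space)
  have si: "set_integrable haar (B \<inter> circle) g" if "B \<in> sets borel" for B
    unfolding set_integrable_def by (intro integrable_mult_indicator cap that g)
  have closed0: "set_lebesgue_integral haar (B \<inter> circle) g = 0" if "closed B" for B
  proof -
    have "set_lebesgue_integral haar (B \<inter> circle) g = (\<integral>z. g z * indicator B z \<partial>haar)"
      unfolding set_lebesgue_integral_def
      by (intro Bochner_Integration.integral_cong refl) (auto simp: indicator_def)
    then show ?thesis by (simp add: integral_closed_zero[OF that])
  qed
  have Int: "Int_stable (Collect closed :: complex set set)"
    by (auto simp: Int_stable_def)
  have Pow: "Collect closed \<subseteq> Pow (UNIV :: complex set)"
    by simp
  have borel: "sets borel = sigma_sets UNIV (Collect closed :: complex set set)"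
    by (simp add: borel_eq_closed)
  have *: "set_lebesgue_integral haar (B \<inter> circle) g = 0" if "B \<in> sigma_sets UNIV (Collect closed)" for B
    using Int Pow that
  proof (induction rule: sigma_sets_induct_disjoint)
    case (basic A)
    then show ?case by (simp add: closed0)
  next
    case empty
    then show ?case by (simp add: set_lebesgue_integral_def)
  next
    case (compl A)
    then have A: "A \<in> sets borel" by (simp add: borel)
    have "set_lebesgue_integral haar (A \<inter> circle \<union> (UNIV - A) \<inter> circle) g
      = set_lebesgue_integral haar (A \<inter> circle) g + set_lebesgue_integral haar ((UNIV - A) \<inter> circle) g"
      by (rule set_integral_Un) (use A in \<open>auto intro!: si\<close>)
    moreover have "A \<inter> circle \<union> (UNIV - A) \<inter> circle = UNIV \<inter> circle" by auto
    ultimately show ?case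
      using compl closed0[of UNIV] by simp
  next
    case (union A)
    then have A: "A i \<in> sets borel" for i by (auto simp: borel)
    have eq: "(\<Union>i. A i \<inter> circle) = (\<Union>i. A i) \<inter> circle" by auto
    have "set_lebesgue_integral haar (\<Union>i. A i \<inter> circle) g
      = (\<Sum>i. set_lebesgue_integral haar (A i \<inter> circle) g)"
    proof (rule lebesgue_integral_countable_add)
      show "A i \<inter> circle \<inter> (A j \<inter> circle) = {}" if "i \<noteq> j" for i j
        using that union(1) by (auto simp: disjoint_family_on_def)
      show "set_integrable haar (\<Union>i. A i \<inter> circle) g"
        unfolding eq by (intro si sets.countable_UN) (use A in auto)
    qed (intro cap A)
    then show ?case
      by (simp only: eq union(3) suminf_zero)
  qed
  then show "set_lebesgue_integral haar A g = 0" if "A \<in> sets haar" for A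
  proof -
    obtain B where "A = circle \<inter> B" "B \<in> sigma_sets UNIV (Collect closed)"
      using \<open>A \<in> sets haar\<close> unfolding sets_haar sets_restrict_space borel by blast
    with * show ?thesis by (simp add: Int_commute)
  qed
qed

end

lemma fourier_complete:
  assumes "\<And>k. cinner f (fourier k) = 0"
  shows "f = 0"
proof -
  define g where "g = rep_l2_circle f"
  have g: "square_integrable haar g" "f = abs_l2_circle g"
    by (simp_all add: g_def square_integrable_rep abs_rep_l2_circle)
  have "(\<integral>z. g z * z powi k \<partial>haar) = 0" for k
  proof -
    have "(\<integral>z. g z * z powi k \<partial>haar) = (\<integral>z. g z * cnj (z powi (- k)) \<partial>haar)"
      by (intro Bochner_Integration.integral_cong refl arg_cong2[of _ _ _ _ "(*)"])
        (simp only: cnj_powi_circle space_haar minus_minus)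
    also have "\<dots> = cinner f (fourier (- k))"
      by (simp add: g(2) fourier_def cinner_abs g(1) square_integrable_powi)
    finally show ?thesis by (simp add: assms)
  qed
  then have "AE z in haar. g z = 0"
    by (intro zero_Fourier_coefficients_imp_AE_zero square_integrable_integrable g(1))
  then show ?thesis
    unfolding g(2) zero_abs by (intro abs_l2_circle_eqI g(1) square_integrable_zero)
qed


section \<open>Wavelet operators and their adjoints\<close>

lemma AE_haarE:
  assumes "AE z in haar. Q z"
  obtains z where "z \<in> circle" "Q z"
proof (rule ccontr)
  assume "\<not> thesis"
  with that have "\<not> Q z" if "z \<in> circle" for z
    using \<open>z \<in> circle\<close> by blast
  then have "AE z in haar. Q z \<longrightarrow> False"
    by (intro AE_I2) simp
  with assms have "AE z in haar. False"
    by (rule AE_mp)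
  then have "emeasure haar (space haar) = 0"
    using AE_iff_measurable[OF sets.top, of haar "\<lambda>_. False"] by (simp del: space_haar)
  then show False
    using prob_space_haar(2) by (simp add: measure_def)
qed

lemma measurable_power_haar: "(\<lambda>z. z ^ N) \<in> measurable haar haar"
  by (intro measurable_to_haar measurable_haar_continuous continuous_intros) (simp add: norm_power)

text \<open>A function of \<open>w ^ N\<close> is constant on the roots of \<open>z\<close>, so that averaging it over them gives
  its value at \<open>z\<close>.\<close>

lemma distr_power_haar:
  assumes N: "N > 0"
  shows "distr haar haar (\<lambda>z. z ^ N) = haar"
proof (rule measure_eqI)
  fix A assume "A \<in> sets (distr haar haar (\<lambda>z. z ^ N))"
  then have A: "A \<in> sets haar" by simp
  define B where "B = (\<lambda>z. z ^ N) -` A \<inter> space haar"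
  have B: "B \<in> sets haar"
    unfolding B_def by (rule measurable_sets[OF measurable_power_haar A])
  have "integrable haar (\<lambda>z. indicat_real B z)"
    using B by (simp add: haar.emeasure_eq_measure)
  from root_average(2)[OF this N] have "real N * measure haar B = (\<integral>z. (\<Sum>w | w ^ N = z. indicat_real B w) \<partial>haar)"
    using B sets.sets_into_space[OF B] by (simp add: Int_absorb2)
  also have "\<dots> = (\<integral>z. real N * indicat_real A z \<partial>haar)"
  proof (intro Bochner_Integration.integral_cong refl)
    fix z assume "z \<in> space haar"
    then have z: "z \<in> circle" "z \<noteq> 0" by auto
    have "(\<Sum>w | w ^ N = z. indicat_real B w) = (\<Sum>w | w ^ N = z. indicat_real A z)"
      using roots_in_circle[OF N z(1)] by (intro sum.cong refl) (auto simp: B_def indicator_def)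
    then show "(\<Sum>w | w ^ N = z. indicat_real B w) = real N * indicat_real A z"
      by (simp add: card_nth_roots[OF z(2) N])
  qed
  also have "\<dots> = real N * measure haar A"
    using sets.sets_into_space[OF A] by (simp add: Int_absorb2)
  finally have "measure haar B = measure haar A"
    using N by simp
  then show "emeasure (distr haar haar (\<lambda>z. z ^ N)) A = emeasure haar A"
    unfolding emeasure_distr[OF measurable_power_haar A] B_def[symmetric]
    by (simp add: haar.emeasure_eq_measure)
qed simp

lemma AE_power_haar:
  assumes N: "N > 0" and "AE z in haar. Q z"
  shows "AE z in haar. Q (z ^ N)"
proof -
  have "AE z in distr haar haar (\<lambda>z. z ^ N). Q z"
    using assms(2) by (simp only: distr_power_haar[OF N])
  then show ?thesis
    by (rule AE_distrD[OF measurable_power_haar])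
qed

lemma square_integrable_power:
  assumes N: "N > 0" and f: "square_integrable haar f"
  shows "square_integrable haar (\<lambda>z. f (z ^ N))"
proof -
  have "integrable (distr haar haar (\<lambda>z. z ^ N)) (\<lambda>z. (cmod (f z))\<^sup>2)"
    using f by (simp add: distr_power_haar[OF N] square_integrable_def)
  then have "integrable haar (\<lambda>z. (cmod (f (z ^ N)))\<^sup>2)"
    by (rule integrable_distr[OF measurable_power_haar])
  moreover have "(\<lambda>z. f (z ^ N)) \<in> borel_measurable haar"
    using f by (intro measurable_compose[OF measurable_power_haar]) (simp add: square_integrable_def)
  ultimately show ?thesis
    by (simp add: square_integrable_def)
qed

lemma continuous_on_trigonometric_polynomial:
  assumes "trigonometric_polynomial f"
  shows "continuous_on circle f"
proof -
  obtain K c where K: "finite K" "\<And>z. z \<in> circle \<Longrightarrow> f z = (\<Sum>k\<in>K. c k * z powi k)"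
    using assms unfolding trigonometric_polynomial_def by metis
  have "continuous_on circle (\<lambda>z. \<Sum>k\<in>K. c k * z powi k)"
    by (intro continuous_on_sum continuous_on_mult continuous_on_const continuous_on_powi)
  then show ?thesis
    by (rule continuous_on_eq) (simp only: K(2))
qed

locale trigonometric_qmf =
  fixes N :: nat and m :: "nat \<Rightarrow> complex \<Rightarrow> complex"
  assumes N2: "N \<ge> 2" and qmf: "qmf_system N m"
    and trig: "\<And>i. i < N \<Longrightarrow> trigonometric_polynomial (m i)"
begin

lemma N_pos: "N > 0"
  using N2 by simp

lemma m_continuous: "i < N \<Longrightarrow> continuous_on circle (m i)"
  by (intro continuous_on_trigonometric_polynomial trig)

lemma qmf_diag:
  assumes "i < N"
  obtains z where "z \<in> circle" "(\<Sum>w | w ^ N = z. m i w * cnj (m i w)) = of_nat N"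
proof -
  have "AE z in haar. 1 / of_nat N * (\<Sum>w | w ^ N = z. m i w * cnj (m i w)) = 1"
    using qmf[unfolded qmf_system_def, THEN conjunct2, rule_format, OF assms assms]
    by (simp only: simp_thms if_True)
  then obtain z where "z \<in> circle" "1 / of_nat N * (\<Sum>w | w ^ N = z. m i w * cnj (m i w)) = 1"
    by (rule AE_haarE)
  with that[of z] show thesis
    using N_pos by (simp add: field_simps)
qed

lemma m_nonzero:
  assumes "i < N"
  shows "\<exists>z\<in>circle. m i z \<noteq> 0"
proof (rule ccontr)
  assume *: "\<not> ?thesis"
  obtain z where z: "z \<in> circle" "(\<Sum>w | w ^ N = z. m i w * cnj (m i w)) = of_nat N"
    by (rule qmf_diag[OF assms])
  have "(\<Sum>w | w ^ N = z. m i w * cnj (m i w)) = 0"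
    using * roots_in_circle[OF N_pos z(1)] by (intro sum.neutral) auto
  with z(2) N_pos show False by simp
qed

text \<open>The modulus of a monomial is constant, and the QMF identity normalizes its mean square over
  the roots to \<open>1\<close>.\<close>

lemma monomial_unimodular:
  assumes "i < N" and mono: "\<And>z. z \<in> circle \<Longrightarrow> m i z = a * z powi k"
  shows "a \<in> circle"
proof -
  obtain z where z: "z \<in> circle" "(\<Sum>w | w ^ N = z. m i w * cnj (m i w)) = of_nat N"
    by (rule qmf_diag[OF assms(1)])
  then have z0: "z \<noteq> 0" by auto
  have "(\<Sum>w | w ^ N = z. m i w * cnj (m i w)) = (\<Sum>w | w ^ N = z. of_real ((cmod a)\<^sup>2))"
  proof (rule sum.cong[OF refl])
    fix w assume "w \<in> {w. w ^ N = z}"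
    then have w: "w \<in> circle" using roots_in_circle[OF N_pos z(1)] by simp
    have "cmod (m i w) = cmod a"
      unfolding mono[OF w] using w by (simp add: norm_mult norm_power_int)
    then show "m i w * cnj (m i w) = of_real ((cmod a)\<^sup>2)"
      by (simp only: complex_norm_square[symmetric])
  qed
  then have "of_nat N * complex_of_real ((cmod a)\<^sup>2) = of_nat N"
    using z(2) by (simp add: card_nth_roots[OF z0 N_pos])
  then have "complex_of_real ((cmod a)\<^sup>2) = 1"
    using N_pos by (simp del: of_real_power)
  then have "(cmod a)\<^sup>2 = 1"
    by (simp only: of_real_eq_1_iff)
  then show ?thesis
    by (simp add: power2_eq_1_iff) (smt (verit) norm_ge_zero)
qed

abbreviation S where "S \<equiv> wavelet_op N m"

lemma square_integrable_wavelet: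
  "i < N \<Longrightarrow> square_integrable haar f \<Longrightarrow> square_integrable haar (\<lambda>z. m i z * f (z ^ N))"
  by (intro square_integrable_mult_bounded m_continuous square_integrable_power N_pos)

text \<open>Null sets pull back to null sets under \<open>z \<mapsto> z ^ N\<close>, so any representative may be used.\<close>

lemma wavelet_op_abs:
  assumes i: "i < N" and f: "square_integrable haar f"
  shows "S i (abs_l2_circle f) = abs_l2_circle (\<lambda>z. m i z * f (z ^ N))"
proof -
  have "AE z in haar. rep_l2_circle (abs_l2_circle f) z = f z"
    by (intro abs_l2_circle_eqD square_integrable_rep f abs_rep_l2_circle)
  then have "AE z in haar. rep_l2_circle (abs_l2_circle f) (z ^ N) = f (z ^ N)"
    by (rule AE_power_haar[OF N_pos])
  then have "AE z in haar. m i z * rep_l2_circle (abs_l2_circle f) (z ^ N) = m i z * f (z ^ N)"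
    by eventually_elim simp
  then show ?thesis
    unfolding wavelet_op_def
    by (intro abs_l2_circle_eqI square_integrable_wavelet i f square_integrable_rep)
qed

text \<open>The adjoint of \<open>S i\<close> on functions.\<close>

definition root_mean :: "nat \<Rightarrow> (complex \<Rightarrow> complex) \<Rightarrow> complex \<Rightarrow> complex" where
  "root_mean i g z = (\<Sum>w | w ^ N = z. cnj (m i w) * g w) / of_nat N"

definition adj :: "nat \<Rightarrow> l2_circle \<Rightarrow> l2_circle" where
  "adj i g = abs_l2_circle (root_mean i (rep_l2_circle g))"

text \<open>By the Cauchy-Schwarz inequality for \<open>N\<close> summands the square of the mean is at most the sum
  of the squares over the roots, which is integrable by \<open>root_average\<close>.\<close>

lemma square_integrable_root_mean:
  assumes i: "i < N" and g: "square_integrable haar g"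
  shows "square_integrable haar (root_mean i g)"
proof -
  have h: "square_integrable haar (\<lambda>z. cnj (m i z) * g z)"
    by (intro square_integrable_mult_bounded g continuous_intros m_continuous i)
  have m: "root_mean i g \<in> borel_measurable haar"
    unfolding root_mean_def using h
    by (intro borel_measurable_divide measurable_root_sum N_pos) (auto simp: square_integrable_def)
  have "integrable haar (\<lambda>z. (\<Sum>w | w ^ N = z. (cmod (cnj (m i w) * g w))\<^sup>2))"
    using h by (intro root_average(1) N_pos) (simp add: square_integrable_def)
  then have "integrable haar (\<lambda>z. (cmod (root_mean i g z))\<^sup>2)"
  proof (rule Bochner_Integration.integrable_bound)
    show "AE z in haar. norm ((cmod (root_mean i g z))\<^sup>2)
        \<le> norm (\<Sum>w | w ^ N = z. (cmod (cnj (m i w) * g w))\<^sup>2)"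
    proof (rule AE_I2)
      fix z assume "z \<in> space haar"
      then have z: "z \<noteq> 0" by auto
      have "(cmod (\<Sum>w | w ^ N = z. cnj (m i w) * g w))\<^sup>2 \<le> (\<Sum>w | w ^ N = z. cmod (cnj (m i w) * g w))\<^sup>2"
        by (intro power_mono norm_sum norm_ge_zero)
      also have "\<dots> \<le> (\<Sum>w | w ^ N = z. (cmod (cnj (m i w) * g w))\<^sup>2) * real N"
        using sum_squared_le_sum_of_squares[of "\<lambda>w. cmod (cnj (m i w) * g w)" "{w. w ^ N = z}"]
        by (simp only: card_nth_roots[OF z N_pos])
      also have "\<dots> \<le> (\<Sum>w | w ^ N = z. (cmod (cnj (m i w) * g w))\<^sup>2) * (real N)\<^sup>2"
        using N_pos by (intro mult_left_mono sum_nonneg) (simp_all add: power2_eq_square)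
      finally have "(cmod (\<Sum>w | w ^ N = z. cnj (m i w) * g w))\<^sup>2 / (real N)\<^sup>2
          \<le> (\<Sum>w | w ^ N = z. (cmod (cnj (m i w) * g w))\<^sup>2)"
        using N_pos by (simp add: divide_le_eq)
      then show "norm ((cmod (root_mean i g z))\<^sup>2)
          \<le> norm (\<Sum>w | w ^ N = z. (cmod (cnj (m i w) * g w))\<^sup>2)"
        by (simp add: root_mean_def norm_divide power_divide sum_nonneg)
    qed
  qed (use m in simp)
  with m show ?thesis by (simp add: square_integrable_def)
qed

text \<open>Average the integrand of the left-hand side over the \<open>N\<close>-th roots of \<open>z\<close>; there the factor
  \<open>f (w ^ N)\<close> has the constant value \<open>f z\<close>.\<close>

lemma wavelet_root_mean_adjoint:
  assumes i: "i < N" and f: "square_integrable haar f" and g: "square_integrable haar g"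
  shows "cinner (S i (abs_l2_circle f)) (abs_l2_circle g)
    = cinner (abs_l2_circle f) (abs_l2_circle (root_mean i g))"
proof -
  define F where "F z = m i z * f (z ^ N) * cnj (g z)" for z
  have F: "integrable haar F"
    unfolding F_def by (intro square_integrable_mult_cnj square_integrable_wavelet i f g)
  have "of_nat N * cinner (S i (abs_l2_circle f)) (abs_l2_circle g) = real N *\<^sub>R (\<integral>z. F z \<partial>haar)"
    by (simp add: wavelet_op_abs i f g cinner_abs square_integrable_wavelet F_def scaleR_conv_of_real)
  also have "\<dots> = (\<integral>z. (\<Sum>w | w ^ N = z. F w) \<partial>haar)"
    by (rule root_average(2)[OF F N_pos, symmetric])
  also have "\<dots> = (\<integral>z. of_nat N * (f z * cnj (root_mean i g z)) \<partial>haar)"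
  proof (intro Bochner_Integration.integral_cong refl)
    fix z
    have "(\<Sum>w | w ^ N = z. F w) = (\<Sum>w | w ^ N = z. f z * cnj (cnj (m i w) * g w))"
      by (intro sum.cong refl) (simp add: F_def)
    also have "\<dots> = of_nat N * (f z * cnj (root_mean i g z))"
      unfolding sum_distrib_left[symmetric] cnj_sum[symmetric] using N_pos by (simp add: root_mean_def)
    finally show "(\<Sum>w | w ^ N = z. F w) = of_nat N * (f z * cnj (root_mean i g z))" .
  qed
  also have "\<dots> = of_nat N * cinner (abs_l2_circle f) (abs_l2_circle (root_mean i g))"
    by (simp add: cinner_abs f square_integrable_root_mean i g)
  finally show ?thesis
    using N_pos by simp
qed

lemma adjoint_pair_wavelet:
  assumes "i < N"
  shows "adjoint_pair (S i) (adj i)"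
  unfolding adjoint_pair_def adj_def
proof (intro allI)
  fix f g
  show "cinner (S i f) g = cinner f (abs_l2_circle (root_mean i (rep_l2_circle g)))"
    using wavelet_root_mean_adjoint[OF assms square_integrable_rep square_integrable_rep, of f g]
    by (simp add: abs_rep_l2_circle)
qed

lemma adj_abs:
  assumes i: "i < N" and g: "square_integrable haar g"
  shows "adj i (abs_l2_circle g) = abs_l2_circle (root_mean i g)"
proof (rule l2_circle_eqI)
  fix h
  show "cinner h (adj i (abs_l2_circle g)) = cinner h (abs_l2_circle (root_mean i g))"
    using wavelet_root_mean_adjoint[OF i square_integrable_rep g, of h]
    by (simp add: adjoint_pair_cinner[OF adjoint_pair_wavelet[OF i]] abs_rep_l2_circle)
qed

definition word_adj :: "nat list \<Rightarrow> l2_circle \<Rightarrow> l2_circle" where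
  "word_adj I = fold adj I"

lemma word_op_Nil [simp]: "word_op T [] = id"
  by (simp add: word_op_def)

lemma word_op_Cons [simp]: "word_op T (i # I) = T i \<circ> word_op T I"
  by (simp add: word_op_def)

lemma word_adj_append: "word_adj (I @ J) f = word_adj J (word_adj I f)"
  by (simp add: word_adj_def)

lemma adjoint_pair_word:
  "set I \<subseteq> {..<N} \<Longrightarrow> adjoint_pair (word_op S I) (word_adj I)"
proof (induction I)
  case Nil
  then show ?case by (simp add: word_adj_def adjoint_pair_def)
next
  case (Cons i I)
  then have "adjoint_pair (S i \<circ> word_op S I) (word_adj I \<circ> adj i)"
    by (intro adjoint_pair_comp adjoint_pair_wavelet) auto
  moreover have "word_adj (i # I) = word_adj I \<circ> adj i"
    by (simp add: word_adj_def)
  ultimately show ?case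
    by (simp only: word_op_Cons)
qed

end


section \<open>Trigonometric polynomials of bounded frequency\<close>

text \<open>The finite dimension of the band supplies the compactness argument, and for large \<open>M\<close> the
  band is invariant under the adjoints of the wavelet operators.\<close>

definition band :: "int \<Rightarrow> l2_circle set" where
  "band M = {v. \<exists>c. v = (\<Sum>k\<in>{-M..M}. c k *\<^sub>C fourier k)}"

lemma cinner_fourier_sum:
  assumes "finite K"
  shows "cinner (\<Sum>k\<in>K. c k *\<^sub>C fourier k) (fourier l) = (if l \<in> K then c l else 0)"
  using assms by (simp add: cinner_sum_left cinner_scaleC_left cinner_fourier if_distrib cong: if_cong)

lemma band_fourier:
  assumes "\<bar>k\<bar> \<le> M"
  shows "fourier k \<in> band M"
proof -
  have "(\<Sum>l\<in>{-M..M}. (if l = k then 1 else 0) *\<^sub>C fourier l) = (\<Sum>l\<in>{-M..M}. if l = k then fourier k else 0)"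
    by (intro sum.cong) auto
  also have "\<dots> = fourier k" using assms by (simp add: abs_le_iff minus_le_iff)
  finally show ?thesis unfolding band_def by (intro CollectI exI[of _ "\<lambda>l. if l = k then 1 else 0"]) simp
qed

lemma band_scaleC: "v \<in> band M \<Longrightarrow> a *\<^sub>C v \<in> band M"
  unfolding band_def by (auto simp: scaleC_sum_right scaleC_scaleC)

lemma band_add:
  assumes "v \<in> band M" "w \<in> band M"
  shows "v + w \<in> band M"
proof -
  obtain c d where "v = (\<Sum>k\<in>{-M..M}. c k *\<^sub>C fourier k)" "w = (\<Sum>k\<in>{-M..M}. d k *\<^sub>C fourier k)"
    using assms by (auto simp: band_def)
  then have "v + w = (\<Sum>k\<in>{-M..M}. (c k + d k) *\<^sub>C fourier k)"
    by (simp add: scaleC_add_left sum.distrib)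
  then show ?thesis by (auto simp: band_def)
qed

lemma band_zero: "0 \<in> band M"
  unfolding band_def by (intro CollectI exI[of _ "\<lambda>_. 0"]) simp

lemma band_sum: "(\<And>k. k \<in> K \<Longrightarrow> f k \<in> band M) \<Longrightarrow> (\<Sum>k\<in>K. f k) \<in> band M"
  by (induction K rule: infinite_finite_induct) (auto intro: band_add band_zero)

lemma cinner_band:
  assumes "v \<in> band M" "\<not> \<bar>k\<bar> \<le> M"
  shows "cinner v (fourier k) = 0"
  using assms by (auto simp: band_def cinner_fourier_sum)

lemma continuous_on_scaleC: "continuous_on A (\<lambda>c. c *\<^sub>C f)"
proof (rule lipschitz_on_continuous_on[of "norm f"])
  show "(norm f)-lipschitz_on A (\<lambda>c. c *\<^sub>C f)"
    by (rule lipschitz_onI) (simp_all add: dist_norm norm_scaleC mult.commute flip: scaleC_diff_left)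
qed

text \<open>A coefficient box is a sum of finitely many compact discs.\<close>

lemma compact_fourier_box:
  assumes "finite K"
  shows "compact {v. \<exists>c. (\<forall>k\<in>K. cmod (c k) \<le> 1) \<and> v = (\<Sum>k\<in>K. c k *\<^sub>C fourier k)}" (is "compact (?B K)")
  using assms
proof (induction K)
  case empty
  then show ?case by simp
next
  case (insert k K)
  have "compact ((\<lambda>c. c *\<^sub>C fourier k) ` cball 0 1)"
    by (intro compact_continuous_image continuous_on_scaleC) simp
  from compact_sums[OF this insert.IH]
  have "compact {x + y |x y. x \<in> (\<lambda>c. c *\<^sub>C fourier k) ` cball 0 1 \<and> y \<in> ?B K}" .
  also have "{x + y |x y. x \<in> (\<lambda>c. c *\<^sub>C fourier k) ` cball 0 1 \<and> y \<in> ?B K} = ?B (insert k K)"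
  proof (intro equalityI subsetI)
    fix v assume "v \<in> {x + y |x y. x \<in> (\<lambda>c. c *\<^sub>C fourier k) ` cball 0 1 \<and> y \<in> ?B K}"
    then obtain a c where ac: "cmod a \<le> 1" "\<forall>k\<in>K. cmod (c k) \<le> 1"
      "v = a *\<^sub>C fourier k + (\<Sum>k\<in>K. c k *\<^sub>C fourier k)"
      by auto
    have "(\<Sum>l\<in>K. (c(k := a)) l *\<^sub>C fourier l) = (\<Sum>l\<in>K. c l *\<^sub>C fourier l)"
      using insert.hyps by (intro sum.cong) auto
    with ac insert.hyps show "v \<in> ?B (insert k K)"
      by (intro CollectI exI[of _ "c(k := a)"]) auto
  next
    fix v assume "v \<in> ?B (insert k K)"
    then obtain c where "\<forall>l\<in>insert k K. cmod (c l) \<le> 1" "v = (\<Sum>l\<in>insert k K. c l *\<^sub>C fourier l)"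
      by auto
    with insert.hyps have "v = c k *\<^sub>C fourier k + (\<Sum>l\<in>K. c l *\<^sub>C fourier l)"
      "c k *\<^sub>C fourier k \<in> (\<lambda>c. c *\<^sub>C fourier k) ` cball 0 1"
      "(\<Sum>l\<in>K. c l *\<^sub>C fourier l) \<in> ?B K"
      by auto
    then show "v \<in> {x + y |x y. x \<in> (\<lambda>c. c *\<^sub>C fourier k) ` cball 0 1 \<and> y \<in> ?B K}"
      by blast
  qed
  finally show ?case .
qed

text \<open>Coefficients of a unit vector have modulus at most \<open>1\<close>, so the sphere is a closed part of
  a coefficient box.\<close>

lemma compact_band_sphere: "compact (band M \<inter> sphere 0 1)"
proof -
  let ?B = "{v. \<exists>c. (\<forall>k\<in>{-M..M}. cmod (c k) \<le> 1) \<and> v = (\<Sum>k\<in>{-M..M}. c k *\<^sub>C fourier k)}"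
  have "band M \<inter> sphere 0 1 = ?B \<inter> sphere 0 1"
  proof (intro equalityI subsetI)
    fix v assume v: "v \<in> band M \<inter> sphere 0 1"
    then obtain c where c: "v = (\<Sum>k\<in>{-M..M}. c k *\<^sub>C fourier k)"
      by (auto simp: band_def)
    have "cmod (c k) \<le> 1" if "k \<in> {-M..M}" for k
    proof -
      have "cinner v (fourier k) = c k"
        using that by (simp add: c cinner_fourier_sum)
      then show ?thesis
        using cinner_Cauchy_Schwarz[of v "fourier k"] v by simp
    qed
    with c v show "v \<in> ?B \<inter> sphere 0 1"
      by (intro IntI CollectI exI[of _ c]) auto
  qed (auto simp: band_def)
  moreover have "closed (sphere (0 :: l2_circle) 1)"
    unfolding sphere_def by (intro closed_Collect_eq continuous_intros)
  ultimately show ?thesis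
    using compact_Int_closed[OF compact_fourier_box[OF finite_atLeastAtMost_int]] by simp
qed

section \<open>Factoring trigonometric polynomials\<close>

definition laurent :: "int \<Rightarrow> complex poly \<Rightarrow> l2_circle" where
  "laurent a p = abs_l2_circle (\<lambda>z. z powi a * poly p z)"

lemma square_integrable_laurent: "square_integrable haar (\<lambda>z. z powi a * poly p z)"
  by (intro square_integrable_continuous continuous_on_mult continuous_on_powi continuous_intros)

lemma fourier_sum_abs:
  assumes "finite K"
  shows "abs_l2_circle (\<lambda>z. \<Sum>k\<in>K. c k * z powi e k) = (\<Sum>k\<in>K. c k *\<^sub>C fourier (e k))"
  using assms
proof (induction K)
  case empty
  then show ?case by (simp add: zero_abs)
next
  case (insert x F)
  have "square_integrable haar (\<lambda>z. \<Sum>k\<in>F. c k * z powi e k)" "square_integrable haar (\<lambda>z. c x * z powi e x)"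
    by (intro square_integrable_continuous continuous_on_sum continuous_on_mult continuous_on_const
        continuous_on_powi)+
  then have "abs_l2_circle (\<lambda>z. \<Sum>k\<in>insert x F. c k * z powi e k)
      = abs_l2_circle (\<lambda>z. c x * z powi e x) + abs_l2_circle (\<lambda>z. \<Sum>k\<in>F. c k * z powi e k)"
    using insert.hyps by (simp add: plus_abs)
  with insert.IH show ?case
    using insert.hyps by (simp add: fourier_def scaleC_abs square_integrable_powi)
qed

lemma laurent_eq_sum: "laurent a p = (\<Sum>k\<le>degree p. coeff p k *\<^sub>C fourier (a + int k))"
proof -
  have "laurent a p = abs_l2_circle (\<lambda>z. \<Sum>k\<le>degree p. coeff p k * z powi (a + int k))"
    unfolding laurent_def
  proof (rule abs_l2_circle_cong[OF square_integrable_laurent])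
    show "square_integrable haar (\<lambda>z. \<Sum>k\<le>degree p. coeff p k * z powi (a + int k))"
      by (intro square_integrable_continuous continuous_on_sum continuous_on_mult continuous_on_const
        continuous_on_powi)
    fix z :: complex assume "z \<in> circle"
    then have "z \<noteq> 0" by auto
    then show "z powi a * poly p z = (\<Sum>k\<le>degree p. coeff p k * z powi (a + int k))"
      by (simp add: poly_altdef sum_distrib_left power_int_add mult_ac)
  qed
  then show ?thesis by (simp add: fourier_sum_abs)
qed

lemma cinner_laurent: "cinner (laurent a p) (fourier (a + int k)) = coeff p k"
proof -
  have "cinner (laurent a p) (fourier (a + int k)) = (\<Sum>l\<le>degree p. if l = k then coeff p k else 0)"
    unfolding laurent_eq_sum cinner_sum_left cinner_scaleC_left cinner_fourier
    by (intro sum.cong) auto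
  then show ?thesis by (simp add: coeff_eq_0)
qed

text \<open>The lowest and the highest coefficient of \<open>p\<close> are nonzero, so their frequencies \<open>a\<close> and
  \<open>a + degree p\<close> must occur in the band.\<close>

lemma laurent_in_band:
  assumes "laurent a p \<in> band M" "poly p 0 \<noteq> 0"
  shows "\<bar>a\<bar> \<le> M" "int (degree p) \<le> 2 * M"
proof -
  have "p \<noteq> 0" using assms(2) by auto
  then have "\<bar>a + int (degree p)\<bar> \<le> M"
    using cinner_band[OF assms(1), of "a + int (degree p)"] by (auto simp: cinner_laurent)
  moreover show "\<bar>a\<bar> \<le> M"
    using cinner_band[OF assms(1), of "a + int 0"] assms(2) unfolding cinner_laurent poly_0_coeff_0 by auto
  ultimately show "int (degree p) \<le> 2 * M" by linarith
qed

text \<open>After multiplication by a power of \<open>z\<close> a trigonometric polynomial is a polynomial; its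
  zero at the origin is removed as a further power of \<open>z\<close>.\<close>

lemma laurent_factorization:
  assumes K: "finite K" and nz: "z0 \<in> circle" "(\<Sum>k\<in>K. c k * z0 powi k) \<noteq> 0"
  shows "\<exists>a p. poly p 0 \<noteq> 0 \<and> (\<forall>z\<in>circle. (\<Sum>k\<in>K. c k * z powi k) = z powi a * poly p z)"
proof -
  define b where "b = (if K = {} then 0 else Min K)"
  have b: "b \<le> k" if "k \<in> K" for k
    using that K by (auto simp: b_def)
  define q where "q = (\<Sum>k\<in>K. monom (c k) (nat (k - b)))"
  have q: "(\<Sum>k\<in>K. c k * z powi k) = z powi b * poly q z" if "z \<in> circle" for z
  proof -
    have "z \<noteq> 0" using that by auto
    then have "z powi k = z powi b * z ^ nat (k - b)" if "k \<in> K" for k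
      using b[OF that] by (simp add: power_int_add[symmetric] flip: power_int_of_nat)
    then show ?thesis
      by (simp add: q_def poly_sum poly_monom sum_distrib_left mult_ac)
  qed
  then have "q \<noteq> 0" using nz by auto
  then obtain p where p: "q = [:-0, 1:] ^ order 0 q * p" "\<not> [:-0, 1:] dvd p"
    using order_decomp by blast
  show ?thesis
  proof (intro exI conjI ballI)
    show "poly p 0 \<noteq> 0" using p(2) by (simp add: dvd_iff_poly_eq_0)
    fix z :: complex assume z: "z \<in> circle"
    then have "z \<noteq> 0" by auto
    have "poly q z = z ^ order 0 q * poly p z"
      by (subst p(1)) (simp add: poly_power)
    then show "(\<Sum>k\<in>K. c k * z powi k) = z powi (b + int (order 0 q)) * poly p z"
      using \<open>z \<noteq> 0\<close> by (simp add: q[OF z] power_int_add)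
  qed
qed

lemma band_laurent:
  assumes "v \<in> band M" "v \<noteq> 0"
  obtains a p where "poly p 0 \<noteq> 0" "v = laurent a p"
proof -
  obtain c where "v = (\<Sum>k\<in>{-M..M}. c k *\<^sub>C fourier k)"
    using assms(1) by (auto simp: band_def)
  then have v: "v = abs_l2_circle (\<lambda>z. \<Sum>k\<in>{-M..M}. c k * z powi k)"
    by (simp add: fourier_sum_abs)
  have si: "square_integrable haar (\<lambda>z. \<Sum>k\<in>{-M..M}. c k * z powi k)"
    by (intro square_integrable_continuous continuous_on_sum continuous_on_mult continuous_on_const
        continuous_on_powi)
  have "\<exists>z\<in>circle. (\<Sum>k\<in>{-M..M}. c k * z powi k) \<noteq> 0"
  proof (rule ccontr)
    assume *: "\<not> ?thesis"
    have "v = 0"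
      unfolding v zero_abs using * by (intro abs_l2_circle_cong si square_integrable_zero) blast
    with assms(2) show False by simp
  qed
  then obtain z0 where z0: "z0 \<in> circle" "(\<Sum>k\<in>{-M..M}. c k * z0 powi k) \<noteq> 0" by blast
  then obtain a p where ap: "poly p 0 \<noteq> 0"
    "\<And>z. z \<in> circle \<Longrightarrow> (\<Sum>k\<in>{-M..M}. c k * z powi k) = z powi a * poly p z"
    using laurent_factorization[OF finite_atLeastAtMost_int z0] by blast
  have "v = laurent a p"
    unfolding v laurent_def by (intro abs_l2_circle_cong si square_integrable_laurent ap(2))
  with ap(1) that show thesis by blast
qed

context trigonometric_qmf
begin

text \<open>Averaging over the roots keeps only the exponents divisible by \<open>N\<close> and divides them by
  \<open>N\<close>: a frequency \<open>k\<close> of \<open>m i\<close> contributes at most \<open>fourier ((n - k) / N)\<close>, and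
  \<open>\<bar>n - k\<bar> / N \<le> 2 M / N \<le> M\<close>.\<close>

lemma adj_fourier_band:
  assumes i: "i < N" and K: "finite K" "\<And>z. z \<in> circle \<Longrightarrow> m i z = (\<Sum>k\<in>K. c k * z powi k)"
    and KM: "\<And>k. k \<in> K \<Longrightarrow> \<bar>k\<bar> \<le> M" and n: "\<bar>n\<bar> \<le> M"
  shows "adj i (fourier n) \<in> band M"
proof -
  define d where "d k = (if int N dvd n - k then cnj (c k) else 0)" for k
  define e where "e k = (n - k) div int N" for k
  have "adj i (fourier n) = abs_l2_circle (root_mean i (\<lambda>z. z powi n))"
    unfolding fourier_def by (intro adj_abs i square_integrable_powi)
  also have "\<dots> = abs_l2_circle (\<lambda>z. \<Sum>k\<in>K. d k * z powi e k)"
  proof (rule abs_l2_circle_cong)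
    show "square_integrable haar (root_mean i (\<lambda>z. z powi n))"
      by (intro square_integrable_root_mean i square_integrable_powi)
    show "square_integrable haar (\<lambda>z. \<Sum>k\<in>K. d k * z powi e k)"
      by (intro square_integrable_continuous continuous_on_sum continuous_on_mult continuous_on_const
        continuous_on_powi)
    fix z assume z: "z \<in> circle"
    have "(\<Sum>w | w ^ N = z. cnj (m i w) * w powi n) = (\<Sum>w | w ^ N = z. \<Sum>k\<in>K. cnj (c k) * w powi (n - k))"
    proof (rule sum.cong[OF refl])
      fix w assume "w \<in> {w. w ^ N = z}"
      then have w: "w \<in> circle" using roots_in_circle[OF N_pos z] by simp
      then have w0: "w \<noteq> 0" by auto
      have "cnj (m i w) * w powi n = (\<Sum>k\<in>K. cnj (c k) * cnj (w powi k) * w powi n)"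
        by (simp add: K(2)[OF w] sum_distrib_right)
      also have "\<dots> = (\<Sum>k\<in>K. cnj (c k) * w powi (n - k))"
        unfolding cnj_powi_circle[OF w] using w0
        by (simp add: mult.assoc power_int_add[symmetric])
      finally show "cnj (m i w) * w powi n = (\<Sum>k\<in>K. cnj (c k) * w powi (n - k))" .
    qed
    also have "\<dots> = (\<Sum>k\<in>K. cnj (c k) * (\<Sum>w | w ^ N = z. w powi (n - k)))"
      by (subst sum.swap) (simp add: sum_distrib_left)
    also have "\<dots> = of_nat N * (\<Sum>k\<in>K. d k * z powi e k)"
      unfolding sum_distrib_left sum_roots_powi[OF N_pos z]
      by (intro sum.cong) (auto simp: d_def e_def)
    finally show "root_mean i (\<lambda>z. z powi n) z = (\<Sum>k\<in>K. d k * z powi e k)"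
      using N_pos by (simp add: root_mean_def)
  qed
  also have "\<dots> = (\<Sum>k\<in>K. d k *\<^sub>C fourier (e k))"
    by (rule fourier_sum_abs[OF K(1)])
  also have "\<dots> \<in> band M"
  proof (rule band_sum)
    fix k assume k: "k \<in> K"
    show "d k *\<^sub>C fourier (e k) \<in> band M"
    proof (cases "int N dvd n - k")
      case True
      then have "int N * e k = n - k" by (simp add: e_def)
      then have "\<bar>int N * e k\<bar> = \<bar>n - k\<bar>" by (simp only:)
      then have "int N * \<bar>e k\<bar> = \<bar>n - k\<bar>" by (simp add: abs_mult)
      moreover have "2 * \<bar>e k\<bar> \<le> int N * \<bar>e k\<bar>"
        using N2 by (intro mult_right_mono) auto
      ultimately have "\<bar>e k\<bar> \<le> M"
        using KM[OF k] n by linarith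
      then show ?thesis by (intro band_scaleC band_fourier)
    next
      case False
      then show ?thesis by (simp add: d_def band_zero)
    qed
  qed
  finally show ?thesis .
qed

lemma adj_band:
  assumes "i < N" and "\<And>n. \<bar>n\<bar> \<le> M \<Longrightarrow> adj i (fourier n) \<in> band M" and "v \<in> band M"
  shows "adj i v \<in> band M"
proof -
  obtain c where "v = (\<Sum>k\<in>{-M..M}. c k *\<^sub>C fourier k)"
    using assms(3) by (auto simp: band_def)
  then have "adj i v = (\<Sum>k\<in>{-M..M}. c k *\<^sub>C adj i (fourier k))"
    by (simp add: adjoint_pair_sum[OF adjoint_pair_wavelet] adjoint_pair_scaleC[OF adjoint_pair_wavelet] assms(1))
  also have "\<dots> \<in> band M"
    by (intro band_sum band_scaleC assms(2)) auto
  finally show ?thesis .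
qed

lemma word_adj_band:
  assumes "\<And>i v. i < N \<Longrightarrow> v \<in> band M \<Longrightarrow> adj i v \<in> band M"
  shows "set I \<subseteq> {..<N} \<Longrightarrow> v \<in> band M \<Longrightarrow> word_adj I v \<in> band M"
  using assms by (induction I arbitrary: v) (auto simp: word_adj_def)

lemma wavelet_laurent:
  assumes i: "i < N" and m: "\<And>z. z \<in> circle \<Longrightarrow> m i z = z powi b * poly r z"
  shows "S i (laurent a p) = laurent (b + int N * a) (r * pcompose p (monom 1 N))"
proof -
  have "S i (laurent a p) = abs_l2_circle (\<lambda>z. m i z * ((z ^ N) powi a * poly p (z ^ N)))"
    unfolding laurent_def by (rule wavelet_op_abs[OF i square_integrable_laurent])
  also have "\<dots> = laurent (b + int N * a) (r * pcompose p (monom 1 N))"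
    unfolding laurent_def
  proof (rule abs_l2_circle_cong[OF square_integrable_wavelet[OF i square_integrable_laurent] square_integrable_laurent])
    fix z assume z: "z \<in> circle"
    then have "z \<noteq> 0" by auto
    then have "z powi (b + int N * a) = z powi b * (z ^ N) powi a"
      by (rule powi_add_mult)
    then show "m i z * ((z ^ N) powi a * poly p (z ^ N))
      = z powi (b + int N * a) * poly (r * pcompose p (monom 1 N)) z"
      by (simp only: m[OF z] poly_mult poly_pcompose poly_monom mult_1_left mult_ac)
  qed
  finally show ?thesis .
qed

text \<open>Constant terms are nonzero, so nothing cancels: each letter multiplies the exponent and the
  degree by \<open>N\<close> and adds its own.\<close>

lemma word_op_laurent:
  assumes "set I \<subseteq> {..<N}"
    and fac: "\<And>i. i < N \<Longrightarrow> poly (r i) 0 \<noteq> 0"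
      "\<And>i z. i < N \<Longrightarrow> z \<in> circle \<Longrightarrow> m i z = z powi b i * poly (r i) z"
    and p: "poly p 0 \<noteq> 0"
  shows "\<exists>q. poly q 0 \<noteq> 0 \<and> degree q = foldr (\<lambda>i n. degree (r i) + N * n) I (degree p) \<and>
    word_op S I (laurent a p) = laurent (foldr (\<lambda>i n. b i + int N * n) I a) q"
  using assms(1)
proof (induction I)
  case Nil
  with p show ?case by auto
next
  case (Cons i I)
  then obtain q where q: "poly q 0 \<noteq> 0" "degree q = foldr (\<lambda>i n. degree (r i) + N * n) I (degree p)"
    "word_op S I (laurent a p) = laurent (foldr (\<lambda>i n. b i + int N * n) I a) q"
    by auto
  have i: "i < N" using Cons.prems by simp
  let ?q = "r i * pcompose q (monom 1 N)"
  have q0: "poly ?q 0 \<noteq> 0"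
    using fac(1)[OF i] q(1) by (simp add: poly_pcompose poly_monom zero_power[OF N_pos])
  then have "degree ?q = degree (r i) + degree (pcompose q (monom 1 N))"
    by (intro degree_mult_eq) auto
  also have "degree (pcompose q (monom 1 N)) = N * degree q"
    by (simp add: degree_pcompose degree_monom_eq)
  finally have "degree ?q = degree (r i) + N * degree q" .
  moreover have "word_op S (i # I) (laurent a p) = laurent (b i + int N * foldr (\<lambda>i n. b i + int N * n) I a) ?q"
    using wavelet_laurent[OF i fac(2)[OF i]] q(3) by simp
  ultimately show ?case
    using q0 q(2) by (intro exI[of _ ?q]) simp
qed

end

section \<open>Bounded exponents force monomial letters\<close>

text \<open>Here \<open>A\<close> and \<open>E\<close> are the exponents and degrees attached to the suffixes of a word, and
  \<open>\<beta>\<close> and \<open>\<delta>\<close> those of its letters. Since \<open>N ^ k * E k \<le> E 0 \<le> B < N ^ B\<close>, the degrees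
  vanish from position \<open>B\<close> on. Solved for \<open>A (Suc k)\<close>, the recursion of the exponents is a
  contraction that preserves \<open>[-M, M]\<close>. The length \<open>L\<close> leaves \<open>2 M + 3\<close> positions from \<open>B\<close>
  to \<open>L\<close>, more than there are integers in this interval, so an exponent repeats; between
  the repetitions the unrolled recursion reads \<open>A s = K + N ^ p * A s\<close>, where \<open>K\<close>
  is the sum in the conclusion.\<close>

lemma repeating_exponents:
  fixes A \<beta> :: "nat \<Rightarrow> int" and E \<delta> :: "nat \<Rightarrow> nat"
  assumes N: "N \<ge> 2" and L: "L = B + 2 * nat M + 2"
    and A: "\<And>k. k < L \<Longrightarrow> A k = \<beta> k + int N * A (Suc k)"
    and E: "\<And>k. k < L \<Longrightarrow> E k = \<delta> k + N * E (Suc k)"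
    and A0: "\<bar>A 0\<bar> \<le> M" and \<beta>: "\<And>k. k < L \<Longrightarrow> \<bar>\<beta> k\<bar> \<le> M" and E0: "E 0 \<le> B"
  shows "\<exists>s p. p \<ge> 1 \<and> s + p \<le> L \<and> (\<forall>j<p. \<delta> (s + j) = 0) \<and>
    (int N ^ p - 1) dvd (\<Sum>j<p. int N ^ j * \<beta> (s + j))"
proof -
  have NE: "N ^ k * E k \<le> E 0" if "k \<le> L" for k
    using that
  proof (induction k)
    case (Suc k)
    then have "N ^ Suc k * E (Suc k) \<le> N ^ k * E k"
      using E[of k] by (simp add: mult.assoc)
    with Suc show ?case by linarith
  qed simp
  have E_zero: "E k = 0" if "B \<le> k" "k \<le> L" for k
  proof (rule ccontr)
    assume "E k \<noteq> 0"
    have "k < 2 ^ k" by (rule less_exp)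
    also have "(2::nat) ^ k \<le> N ^ k" using N by (intro power_mono) auto
    also have "\<dots> \<le> N ^ k * E k" using \<open>E k \<noteq> 0\<close> by simp
    also have "\<dots> \<le> B" using NE[OF that(2)] E0 by simp
    finally show False using that(1) by simp
  qed
  have \<delta>_zero: "\<delta> k = 0" if "B \<le> k" "k < L" for k
    using E_zero[of k] E[of k] that by simp
  have AM: "\<bar>A k\<bar> \<le> M" if "k \<le> L" for k
    using that
  proof (induction k)
    case (Suc k)
    then have "int N * \<bar>A (Suc k)\<bar> = \<bar>A k - \<beta> k\<bar>"
      using A[of k] by (simp add: abs_mult)
    moreover have "2 * \<bar>A (Suc k)\<bar> \<le> int N * \<bar>A (Suc k)\<bar>"
      using N by (intro mult_right_mono) auto
    moreover have "\<bar>A k\<bar> \<le> M" "\<bar>\<beta> k\<bar> \<le> M"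
      using Suc \<beta>[of k] by auto
    ultimately show ?case by linarith
  qed (use A0 in simp)
  have "\<not> inj_on A {B..L}"
  proof
    assume "inj_on A {B..L}"
    moreover have "A ` {B..L} \<subseteq> {-M..M}"
    proof clarsimp
      fix k assume "k \<le> L"
      from AM[OF this] show "- M \<le> A k \<and> A k \<le> M" by linarith
    qed
    ultimately have "card {B..L} \<le> card {-M..M}"
      by (intro card_inj_on_le) auto
    moreover have "0 \<le> M" using A0 by linarith
    ultimately show False by (simp add: L)
  qed
  then obtain x y where xy: "x \<in> {B..L}" "y \<in> {B..L}" "A x = A y" "x \<noteq> y"
    unfolding inj_on_def by blast
  define s t where "s = min x y" and "t = max x y"
  have st: "s < t" "B \<le> s" "t \<le> L" "A s = A t"
    using xy by (auto simp: s_def t_def min_def max_def)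
  have unroll: "A s = (\<Sum>j<p. int N ^ j * \<beta> (s + j)) + int N ^ p * A (s + p)" if "s + p \<le> L" for p
    using that
  proof (induction p)
    case (Suc p)
    then show ?case using A[of "s + p"] by (simp add: algebra_simps)
  qed simp
  define p where "p = t - s"
  have "(\<Sum>j<p. int N ^ j * \<beta> (s + j)) = (int N ^ p - 1) * (- A t)"
    using unroll[of p] st by (simp add: p_def algebra_simps)
  then have "(int N ^ p - 1) dvd (\<Sum>j<p. int N ^ j * \<beta> (s + j))"
    by simp
  then show ?thesis
    using st \<delta>_zero by (intro exI[of _ s] exI[of _ p]) (auto simp: p_def)
qed


section \<open>The spectral measure and its atoms\<close>

lemma topspace_word_space: "topspace (word_space N) = {\<omega>. \<forall>j. \<omega> j < N}"
  by (auto simp: word_space_def PiE_def Pi_def)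

lemma openin_word_borel: "openin (word_space N) U \<Longrightarrow> U \<in> sets (word_borel N)"
  unfolding word_borel_def
  by (subst sets_measure_of) (auto dest: openin_subset intro: sigma_sets.Basic)

lemma cylinder_measurable: "cylinder N I \<in> sets (word_borel N)"
proof (rule openin_word_borel)
  define X where "X j = (if j < length I then {I ! j} \<inter> {..<N} else {..<N})" for j
  have "finite {j. X j \<noteq> {..<N}}"
    by (rule finite_subset[of _ "{..<length I}"]) (auto simp: X_def)
  moreover have "X j \<subseteq> {..<N}" for j by (auto simp: X_def)
  ultimately have "openin (word_space N) (PiE UNIV X)"
    unfolding word_space_def by (simp add: openin_PiE_gen)
  also have "PiE UNIV X = cylinder N I"
    by (auto simp: cylinder_def topspace_word_space X_def PiE_def Pi_def split: if_splits)
  finally show "openin (word_space N) (cylinder N I)" .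
qed

definition prefix :: "(nat \<Rightarrow> nat) \<Rightarrow> nat \<Rightarrow> nat list" where
  "prefix \<omega> k = map \<omega> [0..<k]"

lemma set_prefix: "\<omega> \<in> topspace (word_space N) \<Longrightarrow> set (prefix \<omega> k) \<subseteq> {..<N}"
  by (auto simp: prefix_def topspace_word_space)

lemma cylinder_prefix:
  "cylinder N (prefix \<omega> k) = {\<eta> \<in> topspace (word_space N). \<forall>j<k. \<eta> j = \<omega> j}"
  by (simp add: cylinder_def prefix_def)

lemma singleton_eq_INT_cylinder:
  "\<omega> \<in> topspace (word_space N) \<Longrightarrow> {\<omega>} = (\<Inter>k. cylinder N (prefix \<omega> k))"
  by (auto simp: cylinder_prefix fun_eq_iff)

lemma singleton_measurable:
  assumes "\<omega> \<in> topspace (word_space N)"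
  shows "{\<omega>} \<in> sets (word_borel N)"
  unfolding singleton_eq_INT_cylinder[OF assms]
  by (intro sets.countable_INT) (auto simp: cylinder_measurable)

context
  fixes X :: "'a measure" and P :: "'a set \<Rightarrow> l2_circle \<Rightarrow> l2_circle"
  assumes pvm: "projection_valued_measure X P"
begin

lemma pvm_projection: "E \<in> sets X \<Longrightarrow> orthogonal_projection (P E)"
  using pvm by (simp add: projection_valued_measure_def)

lemma pvm_Int: "E \<in> sets X \<Longrightarrow> F \<in> sets X \<Longrightarrow> P (E \<inter> F) f = P E (P F f)"
  using pvm by (simp add: projection_valued_measure_def)

lemma pvm_sums:
  "range A \<subseteq> sets X \<Longrightarrow> disjoint_family A \<Longrightarrow> (\<lambda>n. P (A n) f) sums P (\<Union>n::nat. A n) f"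
  using pvm by (simp add: projection_valued_measure_def)

lemma pvm_empty: "P {} f = 0"
proof -
  \<comment> \<open>Countably many copies of the empty set: a constant series converges only if it is zero.\<close>
  have "(\<lambda>n::nat. P {} f) sums P (\<Union>n::nat. {}) f"
    by (rule pvm_sums) (auto simp: disjoint_family_on_def)
  then have "summable (\<lambda>n::nat. P {} f)"
    by (rule sums_summable)
  then have "(\<lambda>n::nat. P {} f) \<longlonglongrightarrow> 0"
    by (rule summable_LIMSEQ_zero)
  then show ?thesis by (simp add: LIMSEQ_const_iff)
qed

lemma pvm_Un:
  assumes "E \<in> sets X" "F \<in> sets X" "E \<inter> F = {}"
  shows "P (E \<union> F) f = P E f + P F f"
proof -
  have "(\<lambda>n. P (binaryset E F n) f) sums P (\<Union>n. binaryset E F n) f"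
    using assms by (intro pvm_sums) (auto simp: range_binaryset_eq disjoint_family_on_def binaryset_def)
  moreover have "(\<lambda>n. P (binaryset E F n) f) sums (P E f + P F f)"
    by (rule binaryset_sums[of "\<lambda>A. P A f"]) (rule pvm_empty)
  ultimately show ?thesis
    by (simp add: UN_binaryset_eq sums_unique2)
qed

text \<open>\<open>C 0\<close> is the disjoint union of the intersection and the successive differences; the series
  over the differences telescopes.\<close>

lemma pvm_decseq:
  fixes C :: "nat \<Rightarrow> 'a set"
  assumes C: "range C \<subseteq> sets X" and dec: "decseq C"
  shows "(\<lambda>n. P (C n) f) \<longlonglongrightarrow> P (\<Inter>n. C n) f"
proof -
  define A where "A n = C n - C (Suc n)" for n
  have Cn: "C n \<in> sets X" for n using C by auto
  have An: "A n \<in> sets X" for n by (simp add: A_def Cn sets.Diff)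
  have disj: "A i \<inter> A j = {}" if "i < j" for i j
    using decseqD[OF dec, of "Suc i" j] that by (auto simp: A_def)
  have "disjoint_family A"
    unfolding disjoint_family_on_def
  proof (intro ballI impI)
    fix i j :: nat assume "i \<noteq> j"
    then show "A i \<inter> A j = {}"
      using disj[of i j] disj[of j i] by (cases "i < j") auto
  qed
  then have "(\<lambda>n. P (A n) f) sums P (\<Union>n. A n) f"
    using An by (intro pvm_sums) auto
  moreover have "P (A n) f = P (C n) f - P (C (Suc n)) f" for n
  proof -
    have "C n = A n \<union> C (Suc n)"
      using decseqD[OF dec, of n "Suc n"] by (auto simp: A_def)
    then have "P (C n) f = P (A n) f + P (C (Suc n)) f"
      using pvm_Un[of "A n" "C (Suc n)" f] An Cn by (auto simp: A_def)
    then show ?thesis by simp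
  qed
  moreover have "(\<Sum>i<n. P (C i) f - P (C (Suc i)) f) = P (C 0) f - P (C n) f" for n
    by (induction n) simp_all
  ultimately have "(\<lambda>n. P (C 0) f - P (C n) f) \<longlonglongrightarrow> P (\<Union>n. A n) f"
    by (simp add: sums_def)
  from tendsto_diff[OF tendsto_const[of "P (C 0) f"] this]
  have "(\<lambda>n. P (C n) f) \<longlonglongrightarrow> P (C 0) f - P (\<Union>n. A n) f"
    by simp
  moreover have "P (C 0) f = P (\<Inter>n. C n) f + P (\<Union>n. A n) f"
  proof -
    have "C 0 = (\<Inter>n. C n) \<union> (\<Union>n. A n)"
    proof (intro equalityI subsetI)
      fix x assume x: "x \<in> C 0"
      show "x \<in> (\<Inter>n. C n) \<union> (\<Union>n. A n)"
      proof (rule ccontr)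
        assume n: "\<not> ?thesis"
        have "x \<in> C n" for n
          by (induction n) (use x n in \<open>auto simp: A_def\<close>)
        with n show False by auto
      qed
    qed (use decseqD[OF dec, of 0] in \<open>auto simp: A_def\<close>)
    moreover have "(\<Inter>n. C n) \<in> sets X" "(\<Union>n. A n) \<in> sets X"
      using An Cn by auto
    moreover have "(\<Inter>n. C n) \<inter> (\<Union>n. A n) = {}"
      by (auto simp: A_def)
    ultimately show ?thesis by (simp only: pvm_Un)
  qed
  ultimately show ?thesis by simp
qed

end

locale wavelet_pvm = trigonometric_qmf +
  fixes P :: "(nat \<Rightarrow> nat) set \<Rightarrow> l2_circle \<Rightarrow> l2_circle"
  assumes assoc: "associated_pvm N (wavelet_op N m) P"
begin

lemma pvm: "projection_valued_measure (word_borel N) P"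
  using assoc unfolding associated_pvm_def by (rule conjunct1)

lemma cylinder_projection: "orthogonal_projection (P (cylinder N I))"
  by (rule pvm_projection[OF pvm cylinder_measurable])

lemma P_cylinder:
  assumes "set I \<subseteq> {..<N}"
  shows "P (cylinder N I) f = word_op S I (word_adj I f)"
proof -
  have "P (cylinder N I) = word_op S I \<circ> cadjoint (word_op S I)"
    by (rule assoc[unfolded associated_pvm_def, THEN conjunct2, rule_format, OF assms])
  then show ?thesis
    by (simp add: cadjoint_eq[OF adjoint_pair_word[OF assms]])
qed

text \<open>With \<open>Q\<close> the projection of the cylinder and \<open>T\<close> the adjoint of \<open>S I\<close>, both squared norms
  equal the inner product of \<open>Q f = S I (T f)\<close> with \<open>f\<close>.\<close>

lemma norm_word_adj:
  assumes "set I \<subseteq> {..<N}"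
  shows "norm (word_adj I f) = norm (P (cylinder N I) f)"
proof (rule power2_eq_imp_eq)
  have "complex_of_real ((norm (word_adj I f))\<^sup>2) = cinner (word_adj I f) (word_adj I f)"
    by (rule cinner_self[symmetric])
  also have "\<dots> = cinner (P (cylinder N I) f) f"
    unfolding P_cylinder[OF assms] by (rule adjoint_pair_cinner[OF adjoint_pair_word[OF assms]])
  also have "\<dots> = complex_of_real ((norm (P (cylinder N I) f))\<^sup>2)"
    by (rule norm_projection_sq[OF cylinder_projection, symmetric])
  finally show "(norm (word_adj I f))\<^sup>2 = (norm (P (cylinder N I) f))\<^sup>2"
    by (simp only: of_real_eq_iff)
qed simp_all

lemma tendsto_P_singleton:
  assumes "\<omega> \<in> topspace (word_space N)"
  shows "(\<lambda>k. P (cylinder N (prefix \<omega> k)) f) \<longlonglongrightarrow> P {\<omega>} f"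
  unfolding singleton_eq_INT_cylinder[OF assms]
proof (rule pvm_decseq[OF pvm])
  show "decseq (\<lambda>k. cylinder N (prefix \<omega> k))"
    by (rule decseq_SucI) (auto simp: cylinder_prefix)
qed (auto intro: cylinder_measurable)

section \<open>Monomial cycles give atoms\<close>

lemma wavelet_fourier:
  assumes "i < N" "\<And>z. z \<in> circle \<Longrightarrow> m i z = a * z powi k"
  shows "S i (fourier n) = a *\<^sub>C fourier (k + int N * n)"
proof -
  have "S i (fourier n) = abs_l2_circle (\<lambda>z. m i z * (z ^ N) powi n)"
    unfolding fourier_def by (rule wavelet_op_abs[OF assms(1) square_integrable_powi])
  also have "\<dots> = abs_l2_circle (\<lambda>z. a * z powi (k + int N * n))"
  proof (rule abs_l2_circle_cong[OF square_integrable_wavelet[OF assms(1) square_integrable_powi]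
        square_integrable_cmult[OF square_integrable_powi]])
    fix z assume z: "z \<in> circle"
    then have "z \<noteq> 0" by auto
    then have "z powi (k + int N * n) = z powi k * (z ^ N) powi n"
      by (rule powi_add_mult)
    then show "m i z * (z ^ N) powi n = a * z powi (k + int N * n)"
      by (simp add: assms(2)[OF z])
  qed
  also have "\<dots> = a *\<^sub>C fourier (k + int N * n)"
    unfolding fourier_def by (rule scaleC_abs[OF square_integrable_powi, symmetric])
  finally show ?thesis .
qed

lemma word_op_append: "word_op T (I @ J) f = word_op T I (word_op T J f)"
  by (induction I) simp_all

lemma word_op_scaleC:
  assumes "set I \<subseteq> {..<N}"
  shows "word_op S I (c *\<^sub>C f) = c *\<^sub>C word_op S I f"
proof (rule adjoint_pair_scaleC)
  show "adjoint_pair (word_adj I) (word_op S I)"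
    using adjoint_pair_word[OF assms] by (rule adjoint_pair_swap)
qed

text \<open>Every prefix \<open>I\<close> of \<open>\<omega>\<close> sends \<open>fourier (n t)\<close>, \<open>t\<close> being the length of \<open>I\<close>, to a unimodular
  multiple of \<open>fourier (n 0)\<close>. Hence the adjoint of \<open>S I\<close> applied to \<open>fourier (n 0)\<close> has an inner product
  of modulus \<open>1\<close> with the unit vector \<open>fourier (n t)\<close>, so that it does not shrink \<open>fourier (n 0)\<close>.\<close>

lemma monomial_path_imp_fixed:
  assumes \<omega>: "\<omega> \<in> topspace (word_space N)"
    and mono: "\<And>t z. z \<in> circle \<Longrightarrow> m (\<omega> t) z = a t * z powi k t" and a: "\<And>t. cmod (a t) = 1"
    and n: "\<And>t. n t = k t + int N * n (Suc t)"
  shows "P {\<omega>} (fourier (n 0)) = fourier (n 0)"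
proof -
  have word: "\<exists>\<alpha>. cmod \<alpha> = 1 \<and> word_op S (prefix \<omega> t) (fourier (n t)) = \<alpha> *\<^sub>C fourier (n 0)" for t
  proof (induction t)
    case 0
    show ?case by (intro exI[of _ 1]) (simp add: prefix_def)
  next
    case (Suc t)
    then obtain \<alpha> where \<alpha>: "cmod \<alpha> = 1" "word_op S (prefix \<omega> t) (fourier (n t)) = \<alpha> *\<^sub>C fourier (n 0)"
      by blast
    have "\<omega> t < N" using \<omega> by (simp add: topspace_word_space)
    then have "S (\<omega> t) (fourier (n (Suc t))) = a t *\<^sub>C fourier (n t)"
      using mono n by (subst n) (rule wavelet_fourier)
    then have "word_op S (prefix \<omega> (Suc t)) (fourier (n (Suc t))) = (a t * \<alpha>) *\<^sub>C fourier (n 0)"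
      by (simp add: prefix_def word_op_append word_op_scaleC[OF set_prefix[OF \<omega>, unfolded prefix_def]]
          \<alpha>(2)[unfolded prefix_def] scaleC_scaleC)
    then show ?case
      using a \<alpha>(1) by (intro exI[of _ "a t * \<alpha>"]) (simp add: norm_mult)
  qed
  have "P (cylinder N (prefix \<omega> t)) (fourier (n 0)) = fourier (n 0)" for t
  proof (rule projection_fixed[OF cylinder_projection])
    let ?I = "prefix \<omega> t"
    obtain \<alpha> where \<alpha>: "cmod \<alpha> = 1" "word_op S ?I (fourier (n t)) = \<alpha> *\<^sub>C fourier (n 0)"
      using word by blast
    have "cinner (fourier (n t)) (word_adj ?I (fourier (n 0))) = \<alpha>"
      by (simp add: adjoint_pair_cinner[OF adjoint_pair_word[OF set_prefix[OF \<omega>]]] \<alpha>(2)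
          cinner_scaleC_left cinner_fourier)
    with \<alpha>(1) cinner_Cauchy_Schwarz[of "fourier (n t)" "word_adj ?I (fourier (n 0))"]
    have "1 \<le> norm (word_adj ?I (fourier (n 0)))" by simp
    then show "norm (fourier (n 0)) \<le> norm (P (cylinder N ?I) (fourier (n 0)))"
      by (simp add: norm_word_adj[OF set_prefix[OF \<omega>]])
  qed
  then show ?thesis
    using tendsto_P_singleton[OF \<omega>, of "fourier (n 0)"] by (simp add: LIMSEQ_const_iff)
qed

lemma monomial_cycle_imp_atom:
  assumes p: "p \<ge> 1"
    and cyc: "\<And>j. j < p \<Longrightarrow> i j < N" "\<And>j. j < p \<Longrightarrow> cmod (a j) = 1"
      "\<And>j z. j < p \<Longrightarrow> z \<in> circle \<Longrightarrow> m (i j) z = a j * z powi k j"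
    and dvd: "(int N ^ p - 1) dvd (\<Sum>j<p. int N ^ j * k j)"
  shows "has_atom N P"
proof -
  obtain l where l: "(\<Sum>j<p. int N ^ j * k j) = (int N ^ p - 1) * l"
    using dvd by (rule dvdE)
  \<comment> \<open>\<open>- l\<close> solves \<open>K + N ^ p * n = n\<close>, where \<open>K\<close> is the sum above; \<open>\<nu> j\<close> is what the
    letters \<open>j, \<dots>, p - 1\<close> make of the exponent \<open>- l\<close>.\<close>
  define \<nu> where "\<nu> j = (\<Sum>r<p - j. int N ^ r * k (j + r)) - int N ^ (p - j) * l" for j
  have step: "\<nu> j = k j + int N * \<nu> (Suc j)" if "j < p" for j
  proof -
    have "p - j = Suc (p - Suc j)" using that by simp
    then show ?thesis
      unfolding \<nu>_def by (simp add: sum.lessThan_Suc_shift sum_distrib_left algebra_simps del: sum.lessThan_Suc)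
  qed
  have "\<nu> p = \<nu> 0"
    using l by (simp add: \<nu>_def algebra_simps)
  then have nu: "\<nu> (t mod p) = k (t mod p) + int N * \<nu> (Suc t mod p)" for t
    using step[of "t mod p"] p by (auto simp: mod_Suc)
  define \<omega> where "\<omega> t = i (t mod p)" for t
  have lt: "t mod p < p" for t using p by simp
  have \<omega>: "\<omega> \<in> topspace (word_space N)"
    using cyc(1)[OF lt] by (simp add: \<omega>_def topspace_word_space)
  have "P {\<omega>} (fourier (\<nu> (0 mod p))) = fourier (\<nu> (0 mod p))"
    by (rule monomial_path_imp_fixed[OF \<omega>, of "\<lambda>t. a (t mod p)" "\<lambda>t. k (t mod p)" "\<lambda>t. \<nu> (t mod p)"])
      (simp_all only: \<omega>_def cyc(2,3)[OF lt] nu[symmetric])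
  moreover have "fourier (\<nu> (0 mod p)) \<noteq> 0"
    using norm_fourier[of "\<nu> (0 mod p)"] by (auto simp del: norm_fourier)
  ultimately have "P {\<omega>} \<noteq> (\<lambda>f. 0)"
    by (auto dest: fun_cong[of _ _ "fourier (\<nu> (0 mod p))"])
  with \<omega> show ?thesis by (auto simp: has_atom_def)
qed

section \<open>Atoms give monomial cycles\<close>

lemma norm_P_singleton_le:
  assumes "\<omega> \<in> topspace (word_space N)"
  shows "norm (P {\<omega>} f) \<le> norm (word_adj (prefix \<omega> k) f)"
proof -
  have "{\<omega>} \<inter> cylinder N (prefix \<omega> k) = {\<omega>}"
    using assms by (auto simp: cylinder_prefix)
  then have "P {\<omega>} f = P {\<omega>} (P (cylinder N (prefix \<omega> k)) f)"
    using pvm_Int[OF pvm singleton_measurable[OF assms] cylinder_measurable, of "prefix \<omega> k" f] by simp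
  also have "norm \<dots> \<le> norm (P (cylinder N (prefix \<omega> k)) f)"
    by (rule norm_projection_le[OF pvm_projection[OF pvm singleton_measurable[OF assms]]])
  finally have "norm (P {\<omega>} f) \<le> norm (P (cylinder N (prefix \<omega> k)) f)" .
  then show ?thesis
    by (simp add: norm_word_adj[OF set_prefix[OF assms]])
qed

text \<open>Otherwise compactness of the unit sphere gives a common factor \<open>Q < 1\<close> by which the adjoints
  of all words of length \<open>L\<close> contract the band. Cutting \<open>\<omega>\<close> into blocks of length \<open>L\<close> then makes
  the adjoints of its prefixes tend to \<open>0\<close> at \<open>v0\<close>, although the norm of \<open>P {\<omega>} v0\<close> is a
  positive lower bound.\<close>

lemma atom_imp_fixed_band_vector:
  assumes \<omega>: "\<omega> \<in> topspace (word_space N)" and nz: "P {\<omega>} v0 \<noteq> 0" and v0: "v0 \<in> band M"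
    and adj: "\<And>i v. i < N \<Longrightarrow> v \<in> band M \<Longrightarrow> adj i v \<in> band M"
  obtains I v where "length I = L" "set I \<subseteq> {..<N}" "v \<in> band M" "v \<noteq> 0" "P (cylinder N I) v = v"
proof (rule ccontr)
  assume "\<not> thesis"
  with that have nofix: "P (cylinder N I) v \<noteq> v"
    if "length I = L" "set I \<subseteq> {..<N}" "v \<in> band M" "v \<noteq> 0" for I v
    using \<open>length I = L\<close> \<open>set I \<subseteq> {..<N}\<close> \<open>v \<in> band M\<close> \<open>v \<noteq> 0\<close> by blast
  define W where "W = {I. set I \<subseteq> {..<N} \<and> length I = L}"
  have W: "finite W" unfolding W_def by (rule finite_lists_length_eq) simp
  let ?U = "band M \<inter> sphere 0 1"
  have unit: "of_real (inverse (norm v)) *\<^sub>C v \<in> ?U" if "v \<in> band M" "v \<noteq> 0" for v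
    using that by (auto intro: band_scaleC simp: norm_scaleC norm_inverse)
  have "v0 \<noteq> 0"
    using nz norm_projection_le[OF pvm_projection[OF pvm singleton_measurable[OF \<omega>]], of v0] by auto
  then have U: "?U \<noteq> {}" using unit[OF v0] by blast
  have "\<exists>q<1. \<forall>v\<in>?U. norm (P (cylinder N I) v) \<le> q" if I: "I \<in> W" for I
  proof -
    have "continuous_on ?U (\<lambda>v. norm (P (cylinder N I) v))"
      by (intro continuous_on_norm continuous_on_projection cylinder_projection)
    then obtain x where x: "x \<in> ?U" "\<And>y. y \<in> ?U \<Longrightarrow> norm (P (cylinder N I) y) \<le> norm (P (cylinder N I) x)"
      using continuous_attains_sup[OF compact_band_sphere U] by blast
    have "x \<noteq> 0" "x \<in> band M" "norm x = 1" using x(1) by auto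
    then have "\<not> norm x \<le> norm (P (cylinder N I) x)"
      using nofix[of I x] I projection_fixed[OF cylinder_projection, of x I] by (auto simp: W_def)
    with x(2) \<open>norm x = 1\<close> show ?thesis
      by (intro exI[of _ "norm (P (cylinder N I) x)"]) auto
  qed
  then obtain q where q: "\<And>I. I \<in> W \<Longrightarrow> q I < 1"
    "\<And>I v. I \<in> W \<Longrightarrow> v \<in> ?U \<Longrightarrow> norm (P (cylinder N I) v) \<le> q I"
    by metis
  define Q where "Q = Max (insert 0 (q ` W))"
  have qQ: "q I \<le> Q" if "I \<in> W" for I
    using W that by (auto simp: Q_def)
  have Q0: "0 \<le> Q" "Q < 1" using W q(1) by (auto simp: Q_def)
  have contract: "norm (word_adj I v) \<le> Q * norm v" if I: "I \<in> W" and v: "v \<in> band M" for I v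
  proof (cases "v = 0")
    case True
    then show ?thesis
      using I by (simp add: W_def adjoint_pair_zero[OF adjoint_pair_word])
  next
    case False
    have IN: "set I \<subseteq> {..<N}" using I by (simp add: W_def)
    let ?c = "complex_of_real (inverse (norm v))"
    have "norm (word_adj I (?c *\<^sub>C v)) \<le> Q"
      using q(2)[OF I unit[OF v False]] qQ[OF I] by (simp add: norm_word_adj[OF IN])
    then show ?thesis
      using False unfolding adjoint_pair_scaleC[OF adjoint_pair_word[OF IN]] norm_scaleC norm_of_real
      by (simp add: field_simps)
  qed
  have decay: "norm (word_adj (prefix \<omega> (t * L)) v0) \<le> Q ^ t * norm v0" for t
  proof (induction t)
    case 0
    show ?case by (simp add: prefix_def word_adj_def)
  next
    case (Suc t)
    have split: "prefix \<omega> (Suc t * L) = prefix \<omega> (t * L) @ map \<omega> [t * L..<t * L + L]"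
      using upt_add_eq_append[of 0 "t * L" L] by (simp add: prefix_def add.commute)
    have "map \<omega> [t * L..<t * L + L] \<in> W"
      using \<omega> by (auto simp: W_def topspace_word_space)
    moreover have "word_adj (prefix \<omega> (t * L)) v0 \<in> band M"
      by (intro word_adj_band adj set_prefix \<omega> v0)
    ultimately have "norm (word_adj (prefix \<omega> (Suc t * L)) v0) \<le> Q * norm (word_adj (prefix \<omega> (t * L)) v0)"
      unfolding split word_adj_append by (rule contract)
    also have "\<dots> \<le> Q * (Q ^ t * norm v0)"
      by (intro mult_left_mono Suc.IH Q0)
    finally show ?case by (simp add: mult_ac)
  qed
  have "(\<lambda>t. Q ^ t * norm v0) \<longlonglongrightarrow> 0 * norm v0"
    by (intro tendsto_mult tendsto_const LIMSEQ_realpow_zero Q0)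
  moreover have "norm (P {\<omega>} v0) \<le> Q ^ t * norm v0" for t
    using norm_P_singleton_le[OF \<omega>] decay by (rule order_trans)
  ultimately have "norm (P {\<omega>} v0) \<le> 0 * norm v0"
    by (intro LIMSEQ_le_const) auto
  with nz show False by simp
qed

text \<open>The fixed vector \<open>v\<close> and \<open>u\<close> in \<open>v = S I u\<close> are both Laurent polynomials, so the
  exponents and degrees along the suffixes of \<open>I\<close> obey the recursions of
  \<open>repeating_exponents\<close>; that \<open>v\<close> lies in the band bounds their initial values.\<close>

lemma atom_imp_monomial_cycle:
  assumes "has_atom N P"
  obtains p i a k where "p \<ge> 1"
    "\<And>j. j < p \<Longrightarrow> i j < N \<and> a j \<in> circle \<and> (\<forall>z\<in>circle. m (i j) z = a j * z powi k j)"
    "(int N ^ p - 1) dvd (\<Sum>j<p. int N ^ j * k j)"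
proof -
  obtain \<omega> f where \<omega>: "\<omega> \<in> topspace (word_space N)" and f: "P {\<omega>} f \<noteq> 0"
    using assms by (auto simp: has_atom_def fun_eq_iff)
  have "\<exists>n. P {\<omega>} (fourier n) \<noteq> 0"
  proof (rule ccontr)
    assume "\<not> ?thesis"
    then have "cinner (P {\<omega>} f) (fourier n) = 0" for n
      using adjoint_pair_cinner[OF projection_self_adjoint[OF pvm_projection[OF pvm singleton_measurable[OF \<omega>]]],
          of f "fourier n"] by simp
    then show False using fourier_complete f by blast
  qed
  then obtain n where n: "P {\<omega>} (fourier n) \<noteq> 0" by blast
  have "\<forall>i\<in>{..<N}. \<exists>K c. finite K \<and> (\<forall>z\<in>circle. m i z = (\<Sum>k\<in>K. c k * z powi k))"
    using trig by (auto simp: trigonometric_polynomial_def)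
  then obtain K c where "\<forall>i\<in>{..<N}. finite (K i) \<and> (\<forall>z\<in>circle. m i z = (\<Sum>k\<in>K i. c i k * z powi k))"
    unfolding bchoice_iff by blast
  then have Kc: "\<And>i. i < N \<Longrightarrow> finite (K i)"
    "\<And>i z. i < N \<Longrightarrow> z \<in> circle \<Longrightarrow> m i z = (\<Sum>k\<in>K i. c i k * z powi k)"
    by blast+
  have "\<forall>i\<in>{..<N}. \<exists>b r. poly r 0 \<noteq> 0 \<and> (\<forall>z\<in>circle. m i z = z powi b * poly r z)"
  proof
    fix i assume "i \<in> {..<N}"
    then have i: "i < N" by simp
    obtain z0 where "z0 \<in> circle" "(\<Sum>k\<in>K i. c i k * z0 powi k) \<noteq> 0"
      using m_nonzero[OF i] Kc(2)[OF i] by metis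
    from laurent_factorization[OF Kc(1)[OF i] this]
    show "\<exists>b r. poly r 0 \<noteq> 0 \<and> (\<forall>z\<in>circle. m i z = z powi b * poly r z)"
      using Kc(2)[OF i] by simp
  qed
  then obtain b r where "\<forall>i\<in>{..<N}. poly (r i) 0 \<noteq> 0 \<and> (\<forall>z\<in>circle. m i z = z powi b i * poly (r i) z)"
    unfolding bchoice_iff by blast
  then have fac: "\<And>i. i < N \<Longrightarrow> poly (r i) 0 \<noteq> 0"
    "\<And>i z. i < N \<Longrightarrow> z \<in> circle \<Longrightarrow> m i z = z powi b i * poly (r i) z"
    by blast+
  \<comment> \<open>\<open>M\<close> bounds the starting frequency, the frequencies of the \<open>m i\<close> (for the invariance of the
    band) and the exponents split off from them (for the repetition).\<close>
  define X where "X = insert n (b ` {..<N} \<union> (\<Union>i<N. K i))"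
  define M where "M = Max (abs ` X)"
  have "finite X"
    using Kc(1) by (auto simp: X_def)
  then have "\<bar>x\<bar> \<le> M" if "x \<in> X" for x
    using that by (simp add: M_def)
  then have M: "\<bar>n\<bar> \<le> M" "\<And>i. i < N \<Longrightarrow> \<bar>b i\<bar> \<le> M" "\<And>i k. i < N \<Longrightarrow> k \<in> K i \<Longrightarrow> \<bar>k\<bar> \<le> M"
    by (auto simp: X_def)
  have adj: "adj i v \<in> band M" if "i < N" "v \<in> band M" for i v
    using that(1) _ that(2)
  proof (rule adj_band)
    fix l :: int assume "\<bar>l\<bar> \<le> M"
    with that(1) Kc M(3) show "adj i (fourier l) \<in> band M"
      by (intro adj_fourier_band) auto
  qed
  define B where "B = nat (2 * M)"
  define L where "L = B + 2 * nat M + 2"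
  obtain I v where I: "length I = L" "set I \<subseteq> {..<N}" and v: "v \<in> band M" "v \<noteq> 0" "P (cylinder N I) v = v"
    using atom_imp_fixed_band_vector[OF \<omega> n band_fourier[OF M(1)] adj] by metis
  define u where "u = word_adj I v"
  have vu: "v = word_op S I u"
    using v(3) by (simp add: P_cylinder[OF I(2)] u_def)
  have "u \<in> band M"
    unfolding u_def by (intro word_adj_band adj I v)
  moreover have "u \<noteq> 0"
    using v(2,3) norm_word_adj[OF I(2), of v] by (auto simp: u_def)
  ultimately obtain e q where eq: "poly q 0 \<noteq> 0" "u = laurent e q"
    by (rule band_laurent)
  define A where "A t = foldr (\<lambda>i n. b i + int N * n) (drop t I) e" for t
  define E where "E t = foldr (\<lambda>i n. degree (r i) + N * n) (drop t I) (degree q)" for t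
  obtain w where w: "poly w 0 \<noteq> 0" "degree w = E 0" "v = laurent (A 0) w"
    using word_op_laurent[OF I(2) fac eq(1), of e] by (auto simp: A_def E_def vu eq(2))
  have bounds: "\<bar>A 0\<bar> \<le> M" "E 0 \<le> B"
    using laurent_in_band[of "A 0" w M] w v(1) by (auto simp: B_def)
  have letter: "I ! t < N" if "t < L" for t
    using that I by (metis lessThan_iff nth_mem subsetD)
  have drop: "drop t I = I ! t # drop (Suc t) I" if "t < L" for t
    using that I(1) by (simp add: Cons_nth_drop_Suc)
  have A_rec: "A t = b (I ! t) + int N * A (Suc t)"
    and E_rec: "E t = degree (r (I ! t)) + N * E (Suc t)"
    and b_le: "\<bar>b (I ! t)\<bar> \<le> M" if "t < L" for t
    using M(2)[OF letter[OF that]] by (simp_all add: A_def E_def drop[OF that])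
  obtain s p where sp: "p \<ge> 1" "s + p \<le> L" "\<And>j. j < p \<Longrightarrow> degree (r (I ! (s + j))) = 0"
    "(int N ^ p - 1) dvd (\<Sum>j<p. int N ^ j * b (I ! (s + j)))"
    using repeating_exponents[where A = A and E = E and \<beta> = "\<lambda>t. b (I ! t)"
        and \<delta> = "\<lambda>t. degree (r (I ! t))", OF N2 L_def A_rec E_rec bounds(1) b_le bounds(2)]
    by blast
  show thesis
  proof (rule that[of p "\<lambda>j. I ! (s + j)" "\<lambda>j. coeff (r (I ! (s + j))) 0" "\<lambda>j. b (I ! (s + j))"])
    fix j assume j: "j < p"
    let ?i = "I ! (s + j)"
    have i: "?i < N" using letter j sp(2) by simp
    obtain x where x: "r ?i = [:x:]"
      using degree_eq_zeroE sp(3)[OF j] by blast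
    have "\<forall>z\<in>circle. m ?i z = coeff (r ?i) 0 * z powi b ?i"
      using fac(2)[OF i] by (simp add: x mult.commute)
    moreover from this have "coeff (r ?i) 0 \<in> circle"
      by (intro monomial_unimodular[OF i]) auto
    ultimately show "?i < N \<and> coeff (r ?i) 0 \<in> circle \<and> (\<forall>z\<in>circle. m ?i z = coeff (r ?i) 0 * z powi b ?i)"
      using i by blast
  qed (use sp in auto)
qed

end

theorem theorem5p3:
  fixes N :: nat
    and m :: "nat \<Rightarrow> complex \<Rightarrow> complex"
    and P :: "(nat \<Rightarrow> nat) set \<Rightarrow> l2_circle \<Rightarrow> l2_circle"
  assumes "N \<ge> 2"
    and "qmf_system N m"
    and "\<forall>i<N. trigonometric_polynomial (m i)"
    and "associated_pvm N (wavelet_op N m) P"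
  shows "has_atom N P \<longleftrightarrow>
    (\<exists>p\<ge>1. \<exists>(i :: nat \<Rightarrow> nat) (a :: nat \<Rightarrow> complex) (k :: nat \<Rightarrow> int).
       (\<forall>j<p. i j < N \<and> a j \<in> circle \<and> (\<forall>z\<in>circle. m (i j) z = a j * z powi k j)) \<and>
       (int N ^ p - 1) dvd (\<Sum>j<p. int N ^ j * k j))" (is "_ \<longleftrightarrow> ?cycle")
proof -
  interpret wavelet_pvm N m P
    by standard (use assms in auto)
  show ?thesis
  proof
    assume "has_atom N P"
    then show ?cycle
      by (rule atom_imp_monomial_cycle) blast
  next
    assume ?cycle
    then obtain p i a k where p: "p \<ge> 1"
      and cyc: "\<forall>j<p. i j < N \<and> a j \<in> circle \<and> (\<forall>z\<in>circle. m (i j) z = a j * z powi k j)"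
      and dvd: "(int N ^ p - 1) dvd (\<Sum>j<p. int N ^ j * k j)"
      by blast
    show "has_atom N P"
      by (rule monomial_cycle_imp_atom[OF p _ _ _ dvd, of i a]) (use cyc in auto)
  qed
qed

end
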